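(* For every $p \in \mathbb{N}$ and every integer $n \geq 3$, $\tau_{DP}(K_p \vee C_n) = 3 + p$.
   Context: All graphs are finite and simple; $K_p \vee C_n$ is the join of the complete graph $K_p$ and the cycle $C_n$. A cover of a graph $G$ is a pair $\mathcal{H}=(L,H)$ where $H$ is a graph and $L: V(G) \to \mathcal{P}(V(H))$ satisfies: (1) $\{L(u): u \in V(G)\}$ is a partition of $V(H)$ into $|V(G)|$ parts; (2) $H[L(u)]$ is complete for each $u$; (3) if there is an edge of $H$ between $L(u)$ and $L(v)$ with $u \neq v$, then $uv \in E(G)$; (4) if $uv \in E(G)$, the edges of $H$ between $L(u)$ and $L(v)$ form a (possibly empty) matching. The cover is $m$-fold if $|L(u)|=m$ for all $u$. An $\mathcal{H}$-coloring of $G$ is an independent set of $H$ of size $|V(G)|$. $P_{DP}(G,m)$ is the minimum number of $\mathcal{H}$-colorings over all $m$-fold covers $\mathcal{H}$ of $G$; $P(G,m)$ is the chromatic polynomial. $\tau_{DP}(G)$ is the smallest $N \geq \chi(G)$ such that $P_{DP}(G,m)=P(G,m)$ for all $m \geq N$ (and $\infty$ if $P(G,m)-P_{DP}(G,m)>0$ for infinitely many $m$). *)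

theory Defs
  imports
    "HOL-Library.Ramsey"
    "HOL-Library.Disjoint_Sets"
    "HOL-Library.FuncSet"
    "HOL-Library.Extended_Nat"
begin

record 'a ugraph =
  uverts :: "'a set"
  uedges :: "'a set set"

definition simple_graph :: "'a ugraph \<Rightarrow> bool" where
  "simple_graph G \<longleftrightarrow> finite (uverts G) \<and> uedges G \<subseteq> [uverts G]\<^bsup>2\<^esup>"

definition complete_graph :: "nat \<Rightarrow> nat ugraph" where
  "complete_graph p = \<lparr>uverts = {..<p}, uedges = [{..<p}]\<^bsup>2\<^esup>\<rparr>"

(* A cycle, and a simple graph, only for n \<ge> 3. *)
definition cycle_graph :: "nat \<Rightarrow> nat ugraph" where
  "cycle_graph n = \<lparr>uverts = {..<n}, uedges = {{i, Suc i mod n} |i. i < n}\<rparr>"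

definition graph_join :: "'a ugraph \<Rightarrow> 'b ugraph \<Rightarrow> ('a + 'b) ugraph" where
  "graph_join G H =
     \<lparr>uverts = uverts G <+> uverts H,
      uedges = (image Inl) ` uedges G \<union> (image Inr) ` uedges H
               \<union> {{Inl u, Inr v} |u v. u \<in> uverts G \<and> v \<in> uverts H}\<rparr>"

definition proper_colorings :: "'a ugraph \<Rightarrow> nat \<Rightarrow> ('a \<Rightarrow> nat) set" where
  "proper_colorings G m =
     {c \<in> uverts G \<rightarrow>\<^sub>E {..<m}. \<forall>u v. {u, v} \<in> uedges G \<longrightarrow> c u \<noteq> c v}"

definition chromatic_number :: "'a ugraph \<Rightarrow> nat" where
  "chromatic_number G = (LEAST k. proper_colorings G k \<noteq> {})"

(* The value at the natural number m of the chromatic polynomial. *)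
definition chromatic_poly :: "'a ugraph \<Rightarrow> nat \<Rightarrow> nat" where
  "chromatic_poly G m = card (proper_colorings G m)"

definition edges_between :: "'a ugraph \<Rightarrow> 'a set \<Rightarrow> 'a set \<Rightarrow> 'a set set" where
  "edges_between H A B = {e \<in> uedges H. \<exists>x\<in>A. \<exists>y\<in>B. e = {x, y}}"

(* Only the values of L on uverts G matter. The last conjunct says that the edges between
   L u and L v form a matching, i.e. are pairwise disjoint. *)
definition is_cover :: "'a ugraph \<Rightarrow> ('a \<Rightarrow> 'b set) \<Rightarrow> 'b ugraph \<Rightarrow> bool" where
  "is_cover G L H \<longleftrightarrow>
     simple_graph H \<and>
     partition_on (uverts H) (L ` uverts G) \<and> card (L ` uverts G) = card (uverts G) \<and>
     (\<forall>u\<in>uverts G. clique (L u) (uedges H)) \<and>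
     (\<forall>u\<in>uverts G. \<forall>v\<in>uverts G.
        u \<noteq> v \<and> edges_between H (L u) (L v) \<noteq> {} \<longrightarrow> {u, v} \<in> uedges G) \<and>
     (\<forall>u\<in>uverts G. \<forall>v\<in>uverts G.
        {u, v} \<in> uedges G \<longrightarrow> disjoint (edges_between H (L u) (L v)))"

definition fold_cover :: "nat \<Rightarrow> 'a ugraph \<Rightarrow> ('a \<Rightarrow> 'b set) \<Rightarrow> 'b ugraph \<Rightarrow> bool" where
  "fold_cover m G L H \<longleftrightarrow> is_cover G L H \<and> (\<forall>u\<in>uverts G. card (L u) = m)"

(* L does not occur: a coloring is just an independent set of H of size |V(G)|. *)
definition cover_colorings :: "'a ugraph \<Rightarrow> 'b ugraph \<Rightarrow> 'b set set" where
  "cover_colorings G H =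
     {S. S \<subseteq> uverts H \<and> indep S (uedges H) \<and> card S = card (uverts G)}"

(* The covering graph ranges over graphs with natural numbers as vertices. As covering graphs
   are finite, this is no restriction: see dp_color_function_le. For m = 0 a nonempty G has
   no m-fold cover, since the parts of a partition are nonempty, and the value is junk. *)
definition dp_color_function :: "'a ugraph \<Rightarrow> nat \<Rightarrow> nat" where
  "dp_color_function G m =
     (LEAST k. \<exists>(L :: 'a \<Rightarrow> nat set) H. fold_cover m G L H \<and> k = card (cover_colorings G H))"

definition tau_DP :: "'a ugraph \<Rightarrow> enat" where
  "tau_DP G =
     (if \<exists>\<^sub>\<infinity>m. dp_color_function G m < chromatic_poly G m then \<infinity>
      else enat (LEAST N. chromatic_number G \<le> N \<and>
                          (\<forall>m\<ge>N. dp_color_function G m = chromatic_poly G m)))"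

lemma simple_graph_complete: "simple_graph (complete_graph p)"
  by (simp add: simple_graph_def complete_graph_def)

lemma simple_graph_cycle:
  assumes "n \<ge> 3"
  shows "simple_graph (cycle_graph n)"
proof -
  have "{i, Suc i mod n} \<in> [{..<n}]\<^bsup>2\<^esup>" if "i < n" for i
  proof (cases "Suc i = n")
    case True
    then show ?thesis using assms by (auto simp: nsets_def card_insert_if)
  next
    case False
    then have "Suc i < n" using that by simp
    then show ?thesis by (auto simp: nsets_def card_insert_if)
  qed
  then show ?thesis by (auto simp: simple_graph_def cycle_graph_def)
qed

lemma simple_graph_join:
  assumes "simple_graph G" "simple_graph H"
  shows "simple_graph (graph_join G H)"
proof -
  have 1: "Inl ` e \<in> [uverts G <+> uverts H]\<^bsup>2\<^esup>" if "e \<in> uedges G" for e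
    using that assms(1) by (force simp: simple_graph_def nsets_def card_image)
  have 2: "Inr ` e \<in> [uverts G <+> uverts H]\<^bsup>2\<^esup>" if "e \<in> uedges H" for e
    using that assms(2) by (force simp: simple_graph_def nsets_def card_image)
  show ?thesis
    using assms 1 2
    by (auto simp: simple_graph_def graph_join_def)
qed

lemma fold_cover_nat:
  fixes H :: "'b ugraph" and G :: "'a ugraph"
  assumes "fold_cover m G L H"
  shows "\<exists>(L' :: 'a \<Rightarrow> nat set) H'. fold_cover m G L' H' \<and>
           card (cover_colorings G H') = card (cover_colorings G H)"
proof -
  have cov: "is_cover G L H" and m: "\<And>u. u \<in> uverts G \<Longrightarrow> card (L u) = m"
    using assms by (auto simp: fold_cover_def)
  define V where "V = uverts H"
  define E where "E = uedges H"
  have finV: "finite V" and E: "E \<subseteq> [V]\<^bsup>2\<^esup>"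
    using cov by (auto simp: is_cover_def simple_graph_def V_def E_def)
  obtain f :: "'b \<Rightarrow> nat" where f: "inj_on f V"
    using finite_imp_inj_to_nat_seg[OF finV] by metis
  have EV: "e \<subseteq> V" if "e \<in> E" for e using E that by (auto simp: nsets_def)
  have part: "partition_on V (L ` uverts G)" and cardL: "card (L ` uverts G) = card (uverts G)"
    using cov by (auto simp: is_cover_def V_def)
  have LV: "L u \<subseteq> V" if "u \<in> uverts G" for u
    using part that by (auto simp: partition_on_def)
  define L' where "L' = (\<lambda>u. f ` L u)"
  define H' where "H' = \<lparr>uverts = f ` V, uedges = (image f) ` E\<rparr>"
  have inj: "inj_on (image f) (Pow V)" using f by (rule inj_on_image_Pow)
  have E_iff: "f ` e \<in> (image f) ` E \<longleftrightarrow> e \<in> E" if "e \<subseteq> V" for e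
    using inj EV that by (auto simp: inj_on_def)
  have E_iff2: "{f x, f y} \<in> (image f) ` E \<longleftrightarrow> {x, y} \<in> E" if "x \<in> V" "y \<in> V" for x y
    using E_iff[of "{x, y}"] that by simp
  have simple: "simple_graph H'"
  proof -
    have "f ` e \<in> [f ` V]\<^bsup>2\<^esup>" if "e \<in> E" for e
    proof -
      have "card (f ` e) = card e" using EV[OF that] f by (meson card_image inj_on_subset)
      then show ?thesis using E that by (auto simp: nsets_def)
    qed
    then show ?thesis using finV by (auto simp: simple_graph_def H'_def)
  qed
  have im: "L' ` uverts G = (image f) ` (L ` uverts G)" by (auto simp: L'_def image_image)
  have part': "partition_on (uverts H') (L' ` uverts G)"
  proof -
    have "\<Union>(L' ` uverts G) = f ` V"
      using part by (auto simp: L'_def partition_on_def)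
    moreover have "disjoint (L' ` uverts G)"
      unfolding disjoint_def
    proof (intro ballI impI)
      fix a b assume "a \<in> L' ` uverts G" "b \<in> L' ` uverts G" and ne: "a \<noteq> b"
      then obtain u v where uv: "u \<in> uverts G" "v \<in> uverts G" "a = f ` L u" "b = f ` L v"
        by (auto simp: L'_def)
      then have "L u \<noteq> L v" using ne by auto
      then have "L u \<inter> L v = {}" using uv(1,2) part
        unfolding partition_on_def disjoint_def by blast
      then show "a \<inter> b = {}"
        using uv inj_on_image_Int[OF f LV[OF uv(1)] LV[OF uv(2)]] by simp
    qed
    moreover have "{} \<notin> L' ` uverts G" using part by (auto simp: L'_def partition_on_def)
    ultimately show ?thesis by (simp add: partition_on_def H'_def)
  qed
  have card': "card (L' ` uverts G) = card (uverts G)"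
    unfolding im using cardL inj LV by (metis PowI card_image image_subsetI inj_on_subset)
  have cl: "clique (L' u) (uedges H')" if "u \<in> uverts G" for u
    unfolding clique_def
  proof (intro ballI impI)
    fix a b assume "a \<in> L' u" "b \<in> L' u" and ne: "a \<noteq> b"
    then obtain x y where xy: "x \<in> L u" "y \<in> L u" "a = f x" "b = f y" by (auto simp: L'_def)
    then have "x \<noteq> y" using ne by auto
    then have "{x, y} \<in> E"
      using xy(1,2) cov that unfolding is_cover_def clique_def E_def by blast
    then show "{a, b} \<in> uedges H'"
      using xy E_iff2[of x y] LV[OF that] by (auto simp: H'_def)
  qed
  have eb: "edges_between H' (L' u) (L' v) = (image f) ` edges_between H (L u) (L v)"
    if "u \<in> uverts G" "v \<in> uverts G" for u v
  proof (intro equalityI subsetI)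
    fix e assume "e \<in> edges_between H' (L' u) (L' v)"
    then have "e \<in> (image f) ` E" and "\<exists>x\<in>L u. \<exists>y\<in>L v. e = {f x, f y}"
      by (auto simp: edges_between_def H'_def L'_def)
    then obtain x y where xy: "x \<in> L u" "y \<in> L v" "e = {f x, f y}" "{f x, f y} \<in> (image f) ` E"
      by metis
    have "{x, y} \<in> E" using xy E_iff2[of x y] LV that by blast
    then have "{x, y} \<in> edges_between H (L u) (L v)"
      using xy by (auto simp: edges_between_def E_def)
    moreover have "e = f ` {x, y}" using xy by simp
    ultimately show "e \<in> (image f) ` edges_between H (L u) (L v)" by blast
  next
    fix e assume "e \<in> (image f) ` edges_between H (L u) (L v)"
    then obtain x y where "x \<in> L u" "y \<in> L v" "e = f ` {x, y}" "{x, y} \<in> E"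
      by (auto simp: edges_between_def E_def)
    then show "e \<in> edges_between H' (L' u) (L' v)"
      using E_iff2[of x y] LV that unfolding edges_between_def H'_def L'_def by (auto simp: subset_eq)
  qed
  have mat: "disjoint (edges_between H' (L' u) (L' v))"
    if "u \<in> uverts G" "v \<in> uverts G" "{u, v} \<in> uedges G" for u v
    unfolding eb[OF that(1,2)] disjoint_def
  proof (intro ballI impI)
    fix a b
    assume "a \<in> (image f) ` edges_between H (L u) (L v)"
      and "b \<in> (image f) ` edges_between H (L u) (L v)" and ne: "a \<noteq> b"
    then obtain c d where cd: "c \<in> edges_between H (L u) (L v)"
      "d \<in> edges_between H (L u) (L v)" "a = f ` c" "b = f ` d" by blast
    then have "c \<noteq> d" using ne by auto
    then have "c \<inter> d = {}"
      using cd(1,2) cov that unfolding is_cover_def disjoint_def by blast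
    moreover have "c \<subseteq> V" "d \<subseteq> V" using cd EV by (auto simp: edges_between_def E_def)
    ultimately show "a \<inter> b = {}"
      using cd inj_on_image_Int[OF f] by (metis image_empty)
  qed
  have "is_cover G L' H'"
    unfolding is_cover_def
    using simple part' card' cl mat cov eb by (auto simp: is_cover_def)
  moreover have "card (L' u) = m" if "u \<in> uverts G" for u
    unfolding L'_def using m[OF that] LV[OF that] f by (metis card_image inj_on_subset)
  ultimately have 1: "fold_cover m G L' H'" by (simp add: fold_cover_def)
  have ind: "indep (f ` S) (uedges H') \<longleftrightarrow> indep S E" if "S \<subseteq> V" for S
  proof -
    have "f x \<noteq> f y \<longleftrightarrow> x \<noteq> y" if "x \<in> S" "y \<in> S" for x y
      using f \<open>S \<subseteq> V\<close> that by (auto simp: inj_on_def)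
    then show ?thesis
      using E_iff2 that unfolding indep_def H'_def by (auto simp: subset_eq)
  qed
  have cS: "card (f ` S) = card S" if "S \<subseteq> V" for S
    using f that by (meson card_image inj_on_subset)
  have "cover_colorings G H' = (image f) ` cover_colorings G H"
  proof (intro equalityI subsetI)
    fix T assume T: "T \<in> cover_colorings G H'"
    then obtain S where "S \<subseteq> V" "T = f ` S"
      by (auto simp: cover_colorings_def H'_def subset_image_iff)
    then show "T \<in> (image f) ` cover_colorings G H"
      using T ind cS by (auto simp: cover_colorings_def V_def E_def)
  next
    fix T assume "T \<in> (image f) ` cover_colorings G H"
    then obtain S where "S \<in> cover_colorings G H" "T = f ` S" by blast
    then show "T \<in> cover_colorings G H'"
      using ind cS by (auto simp: cover_colorings_def V_def E_def) (auto simp: H'_def V_def)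
  qed
  moreover have "inj_on (image f) (cover_colorings G H)"
    using inj by (rule inj_on_subset) (auto simp: cover_colorings_def V_def)
  ultimately have "card (cover_colorings G H') = card (cover_colorings G H)"
    by (simp add: card_image)
  with 1 show ?thesis by blast
qed

lemma dp_color_function_le:
  fixes H :: "'b ugraph" and G :: "'a ugraph"
  assumes "fold_cover m G L H"
  shows "dp_color_function G m \<le> card (cover_colorings G H)"
proof -
  obtain L' :: "'a \<Rightarrow> nat set" and H' where "fold_cover m G L' H'"
    and "card (cover_colorings G H') = card (cover_colorings G H)"
    using fold_cover_nat[OF assms] by blast
  then show ?thesis unfolding dp_color_function_def by (metis (mono_tags, lifting) Least_le)
qed

lemma fold_cover_exists:
  assumes "simple_graph G" "m \<ge> 1"
  shows "\<exists>(L :: 'a \<Rightarrow> ('a \<times> nat) set) H. fold_cover m (G :: 'a ugraph) L H"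
proof -
  define L :: "'a \<Rightarrow> ('a \<times> nat) set" where "L = (\<lambda>u. {u} \<times> {..<m})"
  define H where "H = \<lparr>uverts = uverts G \<times> {..<m},
                       uedges = {{(u, i), (u, j)} |u i j. u \<in> uverts G \<and> i < m \<and> j < m \<and> i \<noteq> j}\<rparr>"
  have "simple_graph H"
    using assms by (auto simp: simple_graph_def H_def nsets_def)
  moreover have "inj_on L (uverts G)"
  proof (rule inj_onI)
    fix u v assume "L u = L v"
    moreover have "(u, 0) \<in> L u" using assms(2) by (simp add: L_def)
    ultimately show "u = v" by (simp add: L_def)
  qed
  then have "card (L ` uverts G) = card (uverts G)" by (rule card_image)
  moreover have "partition_on (uverts H) (L ` uverts G)"
  proof (rule partition_onI)
    have "(u, 0) \<in> L u" for u using assms(2) by (simp add: L_def)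
    then show "{} \<notin> L ` uverts G" by (metis empty_iff imageE)
  next
    fix A B assume "A \<in> L ` uverts G" "B \<in> L ` uverts G" "A \<noteq> B"
    then obtain u v where "A = L u" "B = L v" "u \<noteq> v" by blast
    then show "disjnt A B" by (auto simp: L_def disjnt_def)
  next
    show "\<Union> (L ` uverts G) = uverts H" by (auto simp: L_def H_def)
  qed
  moreover have "clique (L u) (uedges H)" if "u \<in> uverts G" for u
    unfolding clique_def L_def H_def using that by auto
  moreover have "edges_between H (L u) (L v) = {}" if "u \<noteq> v" for u v
    using that by (auto simp: edges_between_def L_def H_def doubleton_eq_iff)
  moreover have "u \<noteq> v" if "{u, v} \<in> uedges G" for u v
    using that assms(1) by (auto simp: simple_graph_def nsets_def)
  ultimately have "is_cover G L H"
    unfolding is_cover_def by (auto simp: disjoint_def)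
  then show ?thesis unfolding fold_cover_def L_def by auto
qed

lemma dp_color_function_attained:
  fixes G :: "'a ugraph"
  assumes "simple_graph G" "m \<ge> 1"
  shows "\<exists>(L :: 'a \<Rightarrow> nat set) H. fold_cover m G L H \<and>
           dp_color_function G m = card (cover_colorings G H)"
proof -
  have "\<exists>k. \<exists>(L :: 'a \<Rightarrow> nat set) H. fold_cover m G L H \<and> k = card (cover_colorings G H)"
    using fold_cover_exists[OF assms] fold_cover_nat by blast
  then show ?thesis unfolding dp_color_function_def by (rule LeastI_ex)
qed

end

theory Submission
  imports Defs
begin

text \<open>
  Let \<open>m \<ge> p + 3\<close> and \<open>k = m - p\<close>. Coloring a vertex of \<open>K\<^sub>p\<close> costs every other list at most one
  color, so peeling off \<open>p - 1\<close> of these vertices reduces the lower bound to the wheel \<open>K\<^sub>1 \<or> C\<^sub>n\<close>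
  with lists of size \<open>k + 1\<close>. Extend all matchings to bijections and identify the lists of the rim
  with the list \<open>W\<close> of the apex; the rim edges then carry permutations \<open>s\<^sub>i\<close> of \<open>W\<close>. If the apex gets
  color \<open>j\<close>, the rim is colored from \<open>W - {j}\<close>, where \<open>s\<^sub>i\<close> is a matching contained in its first
  return map. A cycle with \<open>k\<close> colors and permutations along the edges has
  \<open>(k - 1)\<^sup>n + (-1)\<^sup>n (f - 1)\<close> colorings, where \<open>f\<close> is the number of fixed points of the monodromy.
  This settles odd \<open>n\<close>. For even \<open>n\<close>, let \<open>F\<close> be the set of common fixed points of the \<open>s\<^sub>i\<close>.
  A color \<open>j \<in> F\<close> leaves at least \<open>|F| - 1\<close> fixed points. For \<open>j \<notin> F\<close> some first return map has an
  edge that is missing in the cover, and the colorings using this edge gain at least \<open>k\<close> over the bound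
  from \<open>|F|\<close> fixed points. Summing over \<open>j\<close>, gains and losses balance exactly.

  For \<open>m = p + 2\<close> and \<open>n\<close> odd there is no proper coloring. For \<open>n\<close> even, twist one rim edge of the
  canonical cover by swapping two colors: only two colors remain for the rim, so every coloring of
  the twisted cover is proper, but some proper colorings are lost.
\<close>

section \<open>Covers as systems of matchings\<close>

text \<open>Conflicts are kept as a relation on colors for each ordered pair of vertices, so lists
  can be shrunk and vertices deleted without rebuilding a covering graph.\<close>

definition system_colorings ::
    "'a set \<Rightarrow> ('a \<Rightarrow> 'b set) \<Rightarrow> ('a \<Rightarrow> 'a \<Rightarrow> 'b \<Rightarrow> 'b \<Rightarrow> bool) \<Rightarrow> ('a \<Rightarrow> 'b) set" where
  "system_colorings V L E =
     {c \<in> Pi\<^sub>E V L. \<forall>u\<in>V. \<forall>v\<in>V. u \<noteq> v \<longrightarrow> \<not> E u v (c u) (c v)}"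

text \<open>Symmetry turns uniqueness of the partner on one side into uniqueness on both, so the
  conflicts between two vertices form a matching. The lists do not occur, so the property survives
  any change of lists.\<close>

definition matching_system :: "'a ugraph \<Rightarrow> ('a \<Rightarrow> 'a \<Rightarrow> 'b \<Rightarrow> 'b \<Rightarrow> bool) \<Rightarrow> bool" where
  "matching_system G E \<longleftrightarrow>
     (\<forall>u v x y. E u v x y \<longrightarrow> E v u y x) \<and>
     (\<forall>u v x y y'. E u v x y \<longrightarrow> E u v x y' \<longrightarrow> y = y') \<and>
     (\<forall>u v x y. E u v x y \<longrightarrow> {u, v} \<in> uedges G)"

definition cover_conflict ::
    "'a ugraph \<Rightarrow> ('a \<Rightarrow> 'b set) \<Rightarrow> 'b ugraph \<Rightarrow> 'a \<Rightarrow> 'a \<Rightarrow> 'b \<Rightarrow> 'b \<Rightarrow> bool" where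
  "cover_conflict G L H u v x y \<longleftrightarrow>
     u \<in> uverts G \<and> v \<in> uverts G \<and> u \<noteq> v \<and> x \<in> L u \<and> y \<in> L v \<and> {x, y} \<in> uedges H"

lemma system_colorings_mem: "c \<in> system_colorings V L E \<Longrightarrow> u \<in> V \<Longrightarrow> c u \<in> L u"
  by (auto simp: system_colorings_def)

lemma system_colorings_conflict_free:
  "c \<in> system_colorings V L E \<Longrightarrow> u \<in> V \<Longrightarrow> v \<in> V \<Longrightarrow> u \<noteq> v \<Longrightarrow> \<not> E u v (c u) (c v)"
  by (auto simp: system_colorings_def)

lemma system_colorings_ext:
  assumes "c \<in> system_colorings V L E" "d \<in> system_colorings V L' E'" "\<And>u. u \<in> V \<Longrightarrow> c u = d u"
  shows "c = d"
  using assms by (auto simp: system_colorings_def PiE_def intro!: extensionalityI[of c V d])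

lemma finite_system_colorings:
  assumes "finite V" "\<And>u. u \<in> V \<Longrightarrow> finite (L u)"
  shows "finite (system_colorings V L E)"
proof (rule finite_subset)
  show "system_colorings V L E \<subseteq> Pi\<^sub>E V L" by (auto simp: system_colorings_def)
  show "finite (Pi\<^sub>E V L)" using assms by (rule finite_PiE)
qed

lemma matching_system_cover_conflict:
  assumes "is_cover G L H"
  shows "matching_system G (cover_conflict G L H)"
  unfolding matching_system_def
proof (intro conjI allI impI)
  fix u v x y assume *: "cover_conflict G L H u v x y"
  then show "cover_conflict G L H v u y x" by (auto simp: cover_conflict_def insert_commute)
  have "{x, y} \<in> edges_between H (L u) (L v)"
    using * by (auto simp: cover_conflict_def edges_between_def)
  then show uv: "{u, v} \<in> uedges G" using * assms unfolding is_cover_def cover_conflict_def by blast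
next
  fix u v x y y' assume *: "cover_conflict G L H u v x y" "cover_conflict G L H u v x y'"
  then have e: "{x, y} \<in> edges_between H (L u) (L v)" "{x, y'} \<in> edges_between H (L u) (L v)"
    by (auto simp: cover_conflict_def edges_between_def)
  then have "{u, v} \<in> uedges G" using * assms unfolding is_cover_def cover_conflict_def by blast
  then have "disjoint (edges_between H (L u) (L v))"
    using * assms unfolding is_cover_def cover_conflict_def by blast
  then have "{x, y} = {x, y'}" using e disjointD by fastforce
  then show "y = y'" by (auto simp: doubleton_eq_iff)
qed

text \<open>An independent set meets each clique \<open>L u\<close> at most once; having as many
  elements as there are lists, it meets each exactly once. It is thus the image of a unique choice
  function.\<close>

lemma card_cover_colorings:
  assumes G: "finite (uverts G)" and cov: "is_cover G L H"
  shows "card (cover_colorings G H)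
           = card (system_colorings (uverts G) L (cover_conflict G L H))"
proof -
  define V where "V = uverts G"
  have fin: "finite V" using G by (simp add: V_def)
  have finH: "finite (uverts H)" using cov by (auto simp: is_cover_def simple_graph_def)
  have part: "partition_on (uverts H) (L ` V)" and cardL: "card (L ` V) = card V"
    using cov by (auto simp: is_cover_def V_def)
  have injL: "inj_on L V" using cardL fin by (simp add: eq_card_imp_inj_on)
  have LH: "L u \<subseteq> uverts H" if "u \<in> V" for u using part that by (auto simp: partition_on_def)
  have disj: "u = v" if "u \<in> V" "v \<in> V" "x \<in> L u" "x \<in> L v" for u v x
  proof -
    have "L u = L v" using part that unfolding partition_on_def disjoint_def by blast
    then show ?thesis using injL that by (auto dest: inj_onD)
  qed
  have cl: "{x, y} \<in> uedges H" if "u \<in> V" "x \<in> L u" "y \<in> L u" "x \<noteq> y" for u x y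
    using cov that unfolding is_cover_def clique_def V_def by blast
  have "bij_betw (\<lambda>c. c ` V) (system_colorings V L (cover_conflict G L H)) (cover_colorings G H)"
    unfolding bij_betw_def
  proof
    show "inj_on (\<lambda>c. c ` V) (system_colorings V L (cover_conflict G L H))"
    proof (rule inj_onI)
      fix c d assume c: "c \<in> system_colorings V L (cover_conflict G L H)"
        and d: "d \<in> system_colorings V L (cover_conflict G L H)" and eq: "c ` V = d ` V"
      have "c u = d u" if "u \<in> V" for u
      proof -
        obtain v where v: "v \<in> V" "c u = d v" using eq \<open>u \<in> V\<close> by blast
        then have "u = v" using disj[of u v "c u"] system_colorings_mem[OF c] system_colorings_mem[OF d] that by metis
        then show ?thesis using v by simp
      qed
      then show "c = d" using system_colorings_ext[OF c d] by blast
    qed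
    show "(\<lambda>c. c ` V) ` system_colorings V L (cover_conflict G L H) = cover_colorings G H"
    proof (intro equalityI subsetI)
      fix S assume "S \<in> (\<lambda>c. c ` V) ` system_colorings V L (cover_conflict G L H)"
      then obtain c where c: "c \<in> system_colorings V L (cover_conflict G L H)" and S: "S = c ` V"
        by blast
      have cL: "c u \<in> L u" if "u \<in> V" for u using c that by (rule system_colorings_mem)
      have "inj_on c V" using cL disj by (metis inj_onI)
      then have "card S = card V" by (simp add: S card_image)
      moreover have "S \<subseteq> uverts H" using cL LH by (auto simp: S)
      moreover have "indep S (uedges H)"
        unfolding indep_def
      proof (intro ballI impI)
        fix x y assume "x \<in> S" "y \<in> S" "x \<noteq> y"
        then obtain u v where "u \<in> V" "v \<in> V" "x = c u" "y = c v" "u \<noteq> v" using S by blast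
        then show "{x, y} \<notin> uedges H"
          using c cL by (simp add: system_colorings_def cover_conflict_def V_def)
      qed
      ultimately show "S \<in> cover_colorings G H" by (simp add: cover_colorings_def V_def)
    next
      fix S assume "S \<in> cover_colorings G H"
      then have SH: "S \<subseteq> uverts H" and ind: "indep S (uedges H)" and cS: "card S = card V"
        by (auto simp: cover_colorings_def V_def)
      have finS: "finite S" using SH finH by (rule finite_subset)
      have uniq: "x = y" if "u \<in> V" "x \<in> S \<inter> L u" "y \<in> S \<inter> L u" for u x y
        using cl[of u x y] ind that unfolding indep_def by blast
      have ex: "\<exists>u\<in>V. x \<in> L u" if "x \<in> S" for x
        using SH part that by (auto simp: partition_on_def)
      \<comment> \<open>\<open>g\<close> sends a chosen point to the vertex that owns it. It is
        injective because lists are cliques, hence onto by counting, and its inverse is the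
        coloring.\<close>
      then obtain g where g: "\<And>x. x \<in> S \<Longrightarrow> g x \<in> V \<and> x \<in> L (g x)" by metis
      have injg: "inj_on g S" using g uniq by (metis IntI inj_onI)
      have gS: "g ` S = V"
      proof (rule card_subset_eq[OF fin])
        show "g ` S \<subseteq> V" using g by auto
        show "card (g ` S) = card V" using injg cS by (simp add: card_image)
      qed
      define c where "c = restrict (the_inv_into S g) V"
      have gc: "g (c u) = u \<and> c u \<in> S" if "u \<in> V" for u
        using that injg gS by (simp add: c_def f_the_inv_into_f the_inv_into_into)
      have cS': "c ` V = S"
      proof (intro equalityI subsetI)
        fix x assume "x \<in> S"
        then have "c (g x) = x" using g injg by (simp add: c_def the_inv_into_f_f)
        then show "x \<in> c ` V" using g \<open>x \<in> S\<close> by (metis image_eqI)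
      qed (use gc in auto)
      have cc: "c u \<in> L u" if "u \<in> V" for u using gc[OF that] g by metis
      have "\<not> cover_conflict G L H u v (c u) (c v)" if "u \<in> V" "v \<in> V" for u v
      proof
        assume con: "cover_conflict G L H u v (c u) (c v)"
        then have "c u \<noteq> c v" using gc that by (metis cover_conflict_def)
        then show False using con ind gc that unfolding indep_def cover_conflict_def by blast
      qed
      then have "c \<in> system_colorings V L (cover_conflict G L H)"
        using cc by (auto simp: system_colorings_def c_def)
      then show "S \<in> (\<lambda>c. c ` V) ` system_colorings V L (cover_conflict G L H)" using cS' by blast
    qed
  qed
  then show ?thesis by (metis bij_betw_same_card V_def)
qed

text \<open>The system is realized by a genuine cover on \<open>V \<times> {..<m}\<close>, and the
  second components of a coloring of that cover form a coloring of the system. As the DP color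
  function is a minimum, this injection suffices.\<close>

lemma dp_color_function_le_system:
  fixes G :: "'a ugraph"
  assumes G: "simple_graph G" and m: "m \<ge> 1" and E: "matching_system G E"
  shows "dp_color_function G m \<le> card (system_colorings (uverts G) (\<lambda>_. {..<m}) E)"
proof -
  define V where "V = uverts G"
  define L :: "'a \<Rightarrow> ('a \<times> nat) set" where "L = (\<lambda>u. {u} \<times> {..<m})"
  define H where "H = \<lparr>uverts = V \<times> {..<m},
     uedges = {{(u, i), (u, j)} |u i j. u \<in> V \<and> i < m \<and> j < m \<and> i \<noteq> j}
            \<union> {{(u, i), (v, j)} |u v i j. u \<in> V \<and> v \<in> V \<and> i < m \<and> j < m \<and> E u v i j}\<rparr>"
  have sym: "E v u y x" if "E u v x y" for u v x y using E that by (auto simp: matching_system_def)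
  have fn: "y = y'" if "E u v x y" "E u v x y'" for u v x y y'
    using E that unfolding matching_system_def by blast
  have EG: "{u, v} \<in> uedges G" if "E u v x y" for u v x y
    using E that unfolding matching_system_def by blast
  have Gne: "u \<noteq> v" if "{u, v} \<in> uedges G" for u v
    using that G by (auto simp: simple_graph_def nsets_def)
  have fin: "finite V" using G by (auto simp: simple_graph_def V_def)
  have edge: "{(u, i), (v, j)} \<in> uedges H \<longleftrightarrow> E u v i j"
    if "u \<in> V" "v \<in> V" "i < m" "j < m" "u \<noteq> v" for u v i j
  proof
    assume "{(u, i), (v, j)} \<in> uedges H"
    then obtain u' v' i' j' where "{(u, i), (v, j)} = {(u', i'), (v', j')}" "E u' v' i' j'"
      using \<open>u \<noteq> v\<close> by (auto simp: H_def doubleton_eq_iff)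
    then show "E u v i j" using sym by (auto simp: doubleton_eq_iff)
  qed (use that in \<open>auto simp: H_def\<close>)
  have eb: "\<exists>i j. e = {(u, i), (v, j)} \<and> E u v i j"
    if uv: "u \<in> V" "v \<in> V" "u \<noteq> v" "e \<in> edges_between H (L u) (L v)" for u v e
  proof -
    obtain i j where "e = {(u, i), (v, j)}" "i < m" "j < m" "e \<in> uedges H"
      using uv(4) by (auto simp: edges_between_def L_def)
    then show ?thesis using edge uv(1-3) by metis
  qed
  have "simple_graph H"
  proof -
    have "{(u, i), (v, j)} \<in> [V \<times> {..<m}]\<^bsup>2\<^esup>"
      if "u \<in> V" "v \<in> V" "i < m" "j < m" "E u v i j" for u v i j
      using Gne[OF EG[OF that(5)]] that by (auto simp: nsets_def)
    then show ?thesis using fin by (auto simp: simple_graph_def H_def) (auto simp: nsets_def)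
  qed
  \<comment> \<open>Positive \<open>m\<close> keeps the lists nonempty, so each list determines its
    vertex.\<close>
  moreover have "inj_on L V"
  proof (rule inj_onI)
    fix u v assume "L u = L v"
    moreover have "(u, 0) \<in> L u" using m by (simp add: L_def)
    ultimately show "u = v" by (simp add: L_def)
  qed
  then have "card (L ` V) = card V" by (rule card_image)
  moreover have "partition_on (uverts H) (L ` V)"
  proof (rule partition_onI)
    have "(u, 0) \<in> L u" for u using m by (simp add: L_def)
    then show "{} \<notin> L ` V" by (metis empty_iff imageE)
  next
    fix A B assume "A \<in> L ` V" "B \<in> L ` V" "A \<noteq> B"
    then obtain u v where "A = L u" "B = L v" "u \<noteq> v" by blast
    then show "disjnt A B" by (auto simp: L_def disjnt_def)
  next
    show "\<Union> (L ` V) = uverts H" by (auto simp: L_def H_def)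
  qed
  moreover have "clique (L u) (uedges H)" if "u \<in> V" for u
    unfolding clique_def L_def H_def using that by auto
  moreover have "{u, v} \<in> uedges G"
    if "u \<in> V" "v \<in> V" "u \<noteq> v" "edges_between H (L u) (L v) \<noteq> {}" for u v
    using eb[OF that(1-3)] that(4) EG by blast
  moreover have "disjoint (edges_between H (L u) (L v))"
    if uv: "u \<in> V" "v \<in> V" "{u, v} \<in> uedges G" for u v
    unfolding disjoint_def
  proof (intro ballI impI)
    fix e f assume "e \<in> edges_between H (L u) (L v)" "f \<in> edges_between H (L u) (L v)" "e \<noteq> f"
    then obtain i j i' j' where "e = {(u, i), (v, j)}" "E u v i j" "f = {(u, i'), (v, j')}" "E u v i' j'"
      using eb[OF uv(1,2) Gne[OF uv(3)]] by metis
    then show "e \<inter> f = {}"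
      using \<open>e \<noteq> f\<close> fn[of u v i j j'] fn[of v u j i i'] sym[of u v i j] sym[of u v i' j']
        Gne[OF uv(3)] by auto
  qed
  ultimately have cov: "is_cover G L H" by (auto simp: is_cover_def V_def)
  then have "fold_cover m G L H" by (simp add: fold_cover_def L_def)
  then have "dp_color_function G m \<le> card (cover_colorings G H)" by (rule dp_color_function_le)
  also have "\<dots> = card (system_colorings V L (cover_conflict G L H))"
    using card_cover_colorings[OF _ cov] fin by (simp add: V_def)
  also have "\<dots> \<le> card (system_colorings V (\<lambda>_. {..<m}) E)"
  proof (rule card_inj_on_le)
    show "finite (system_colorings V (\<lambda>_. {..<m}) E)" using fin by (simp add: finite_system_colorings)
    show "inj_on (\<lambda>c. restrict (snd \<circ> c) V) (system_colorings V L (cover_conflict G L H))"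
    proof (rule inj_onI)
      fix c d assume c: "c \<in> system_colorings V L (cover_conflict G L H)"
        and d: "d \<in> system_colorings V L (cover_conflict G L H)"
        and eq: "restrict (snd \<circ> c) V = restrict (snd \<circ> d) V"
      have "c u = d u" if "u \<in> V" for u
      proof -
        have "c u \<in> L u" "d u \<in> L u"
          using system_colorings_mem[OF c that] system_colorings_mem[OF d that] .
        moreover have "snd (c u) = snd (d u)" using fun_cong[OF eq, of u] that by simp
        ultimately show ?thesis by (auto simp: L_def prod_eq_iff)
      qed
      then show "c = d" using system_colorings_ext[OF c d] by blast
    qed
    show "(\<lambda>c. restrict (snd \<circ> c) V) ` system_colorings V L (cover_conflict G L H)
            \<subseteq> system_colorings V (\<lambda>_. {..<m}) E"
    proof (rule image_subsetI)
      fix c assume c: "c \<in> system_colorings V L (cover_conflict G L H)"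
      have cu: "c u = (u, snd (c u)) \<and> snd (c u) < m" if "u \<in> V" for u
      proof -
        have "c u \<in> L u" using c that by (rule system_colorings_mem)
        then show ?thesis by (auto simp: L_def)
      qed
      have "\<not> E u v (snd (c u)) (snd (c v))" if "u \<in> V" "v \<in> V" "u \<noteq> v" for u v
      proof
        assume "E u v (snd (c u)) (snd (c v))"
        then have "{c u, c v} \<in> uedges H" using edge cu that by metis
        then show False using c that by (auto simp: system_colorings_def cover_conflict_def V_def)
      qed
      then show "restrict (snd \<circ> c) V \<in> system_colorings V (\<lambda>_. {..<m}) E"
        using cu by (auto simp: system_colorings_def)
    qed
  qed
  finally show ?thesis by (simp add: V_def)
qed

section \<open>Cycles with permutations along the edges\<close>

text \<open>These color a path of \<open>l\<close> edges with prescribed end colors;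
  \<open>t i\<close> sends the color at position \<open>i\<close> to the color it forbids at
  \<open>Suc i\<close>.\<close>

definition walks :: "'b set \<Rightarrow> (nat \<Rightarrow> 'b \<Rightarrow> 'b) \<Rightarrow> nat \<Rightarrow> 'b \<Rightarrow> 'b \<Rightarrow> (nat \<Rightarrow> 'b) set" where
  "walks A t l x y =
     {d \<in> {..l} \<rightarrow>\<^sub>E A. d 0 = x \<and> d l = y \<and> (\<forall>i<l. d (Suc i) \<noteq> t i (d i))}"

definition cycle_colorings :: "nat \<Rightarrow> 'b set \<Rightarrow> (nat \<Rightarrow> 'b \<Rightarrow> 'b) \<Rightarrow> (nat \<Rightarrow> 'b) set" where
  "cycle_colorings n A t = {d \<in> {..<n} \<rightarrow>\<^sub>E A. \<forall>i<n. d (Suc i mod n) \<noteq> t i (d i)}"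

lemma cycle_colorings_step:
  "d \<in> cycle_colorings n A t \<Longrightarrow> i < n \<Longrightarrow> d (Suc i mod n) \<noteq> t i (d i)"
  by (auto simp: cycle_colorings_def)

lemma cycle_colorings_mem: "d \<in> cycle_colorings n A t \<Longrightarrow> i < n \<Longrightarrow> d i \<in> A"
  by (auto simp: cycle_colorings_def)

lemma cycle_coloringsI:
  assumes "d \<in> {..<n} \<rightarrow>\<^sub>E A" "\<And>i. i < n \<Longrightarrow> d (Suc i mod n) \<noteq> t i (d i)"
  shows "d \<in> cycle_colorings n A t"
  using assms by (simp add: cycle_colorings_def)

lemma cycle_colorings_ext:
  assumes "c \<in> cycle_colorings n A t" "d \<in> cycle_colorings n B u" "\<And>i. i < n \<Longrightarrow> c i = d i"
  shows "c = d"
  using assms by (auto simp: cycle_colorings_def PiE_def intro!: extensionalityI[of c "{..<n}" d])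

primrec monodromy :: "(nat \<Rightarrow> 'b \<Rightarrow> 'b) \<Rightarrow> nat \<Rightarrow> 'b \<Rightarrow> 'b" where
  "monodromy t 0 x = x"
| "monodromy t (Suc l) x = t l (monodromy t l x)"

text \<open>The generic number of walks, for an end color that is not the image of the start under
  the monodromy; for nonzero \<open>k\<close> it is
  \<open>((k - 1) ^ l - (- 1) ^ l) / k\<close>.\<close>

primrec walk_number :: "int \<Rightarrow> nat \<Rightarrow> int" where
  "walk_number k 0 = 0"
| "walk_number k (Suc l) = (k - 1) ^ l - walk_number k l"

lemma walk_number_closed_form: "k * walk_number k l + (- 1) ^ l = (k - 1) ^ l"
  by (induction l) (simp_all add: algebra_simps)

lemma finite_walks: "finite A \<Longrightarrow> finite (walks A t l x y)"
  by (rule finite_subset[of _ "{..l} \<rightarrow>\<^sub>E A"]) (auto simp: walks_def intro: finite_PiE)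

lemma finite_cycle_colorings: "finite A \<Longrightarrow> finite (cycle_colorings n A t)"
  by (rule finite_subset[of _ "{..<n} \<rightarrow>\<^sub>E A"]) (auto simp: cycle_colorings_def intro: finite_PiE)

lemma monodromy_mem:
  assumes "\<And>i. i < l \<Longrightarrow> bij_betw (t i) A A" "x \<in> A"
  shows "monodromy t l x \<in> A"
  using assms by (induction l) (auto simp: bij_betw_def)

lemma card_walks_Suc:
  assumes "finite A" "y \<in> A"
  shows "card (walks A t (Suc l) x y) = (\<Sum>z\<in>{z\<in>A. t l z \<noteq> y}. card (walks A t l x z))"
proof -
  have "bij_betw (\<lambda>d. restrict d {..l}) (walks A t (Suc l) x y)
          (\<Union>z\<in>{z\<in>A. t l z \<noteq> y}. walks A t l x z)"
  proof (rule bij_betw_byWitness[where f' = "\<lambda>d. d(Suc l := y)"])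
    show "\<forall>d\<in>walks A t (Suc l) x y. (restrict d {..l})(Suc l := y) = d"
      by (auto simp: walks_def fun_eq_iff PiE_def extensional_def)
    show "\<forall>d\<in>\<Union>z\<in>{z\<in>A. t l z \<noteq> y}. walks A t l x z. restrict (d(Suc l := y)) {..l} = d"
      by (auto simp: walks_def fun_eq_iff PiE_def extensional_def)
    show "(\<lambda>d. restrict d {..l}) ` walks A t (Suc l) x y
            \<subseteq> (\<Union>z\<in>{z\<in>A. t l z \<noteq> y}. walks A t l x z)"
    proof (rule image_subsetI)
      fix d assume d: "d \<in> walks A t (Suc l) x y"
      then have "t l (d l) \<noteq> y" "d l \<in> A" by (auto simp: walks_def)
      moreover have "restrict d {..l} \<in> walks A t l x (d l)"
        using d by (auto simp: walks_def PiE_iff)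
      ultimately show "restrict d {..l} \<in> (\<Union>z\<in>{z\<in>A. t l z \<noteq> y}. walks A t l x z)" by blast
    qed
    show "(\<lambda>d. d(Suc l := y)) ` (\<Union>z\<in>{z\<in>A. t l z \<noteq> y}. walks A t l x z)
            \<subseteq> walks A t (Suc l) x y"
      using assms(2) by (auto simp: walks_def PiE_iff extensional_def less_Suc_eq)
  qed
  then have "card (walks A t (Suc l) x y) = card (\<Union>z\<in>{z\<in>A. t l z \<noteq> y}. walks A t l x z)"
    by (rule bij_betw_same_card)
  also have "\<dots> = (\<Sum>z\<in>{z\<in>A. t l z \<noteq> y}. card (walks A t l x z))"
    using assms(1) by (intro card_UN_disjoint) (auto simp: finite_walks, auto simp: walks_def)
  finally show ?thesis .
qed

text \<open>The last step into \<open>y\<close> excludes one preceding color, the preimage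
  \<open>z0\<close> of \<open>y\<close>. Hence the count is the total \<open>(k - 1) ^ l\<close>
  minus the count ending at \<open>z0\<close>, and this subtraction flips the sign of the
  correction.\<close>

lemma card_walks:
  assumes A: "finite A" "card A = k" and t: "\<And>i. i < l \<Longrightarrow> bij_betw (t i) A A"
    and "x \<in> A" "y \<in> A"
  shows "int (card (walks A t l x y))
           = walk_number k l + (if monodromy t l x = y then (- 1) ^ l else 0)"
  using t \<open>y \<in> A\<close>
proof (induction l arbitrary: y)
  case 0
  have "walks A t 0 x y = (if x = y then {\<lambda>i\<in>{..0}. x} else {})"
    using \<open>x \<in> A\<close> by (auto simp: walks_def PiE_iff extensional_def fun_eq_iff)
  then show ?case by simp
next
  case (Suc l)
  have bij: "bij_betw (t l) A A" using Suc.prems(1) by simp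
  obtain z0 where z0: "z0 \<in> A" "t l z0 = y" using bij Suc.prems(2)
    by (metis bij_betw_imp_surj_on imageE)
  have z0_iff: "t l z = y \<longleftrightarrow> z = z0" if "z \<in> A" for z
    using bij z0 that by (auto simp: bij_betw_def inj_on_def)
  then have eq: "{z\<in>A. t l z \<noteq> y} = A - {z0}" by auto
  have mem: "monodromy t l x \<in> A" using Suc.prems(1) \<open>x \<in> A\<close> by (intro monodromy_mem) auto
  have IH: "int (card (walks A t l x z))
      = walk_number k l + (if monodromy t l x = z then (- 1) ^ l else 0)" if "z \<in> A" for z
    using Suc.IH Suc.prems(1) that by simp
  have "int (card (walks A t (Suc l) x y)) = (\<Sum>z\<in>A - {z0}. int (card (walks A t l x z)))"
    using card_walks_Suc[OF A(1) Suc.prems(2)] by (simp add: eq)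
  also have "\<dots> = (\<Sum>z\<in>A. int (card (walks A t l x z))) - int (card (walks A t l x z0))"
    using A(1) z0 by (simp add: sum_diff1)
  also have "(\<Sum>z\<in>A. int (card (walks A t l x z)))
      = (\<Sum>z\<in>A. walk_number k l + (if monodromy t l x = z then (- 1) ^ l else 0))"
    by (rule sum.cong) (simp_all add: IH)
  also have "\<dots> = (int k - 1) ^ l"
    using A mem by (simp add: sum.distrib sum.delta' walk_number_closed_form)
  finally show ?case using IH[OF z0(1)] z0_iff[OF mem] by auto
qed

text \<open>Fix the colors \<open>x\<close> and \<open>z\<close> at the first and last positions:
  the closing edge then demands \<open>t l z \<noteq> x\<close>, which is the final step of a walk
  that returns to \<open>x\<close>.\<close>

lemma card_cycle_colorings_eq_sum:
  assumes "finite A" "n \<ge> 2"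
  shows "card (cycle_colorings n A t) = (\<Sum>x\<in>A. card (walks A t n x x))"
proof -
  obtain l where n: "n = Suc l" "l \<ge> 1" using assms(2) by (cases n) auto
  have "cycle_colorings n A t = (\<Union>x\<in>A. \<Union>z\<in>{z\<in>A. t l z \<noteq> x}. walks A t l x z)"
    (is "?L = ?R")
  proof (intro equalityI subsetI)
    fix d assume d: "d \<in> ?L"
    have step: "d (Suc i) \<noteq> t i (d i)" if "i < l" for i
    proof -
      have "d (Suc i mod n) \<noteq> t i (d i)" using cycle_colorings_step[OF d, of i] that n by simp
      then show ?thesis using that n by simp
    qed
    have "d (Suc l mod n) \<noteq> t l (d l)" using cycle_colorings_step[OF d, of l] n by simp
    then have "t l (d l) \<noteq> d 0" using n by (simp add: eq_commute)
    moreover have "d 0 \<in> A" "d l \<in> A" using cycle_colorings_mem[OF d] n by auto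
    moreover have "d \<in> walks A t l (d 0) (d l)"
      using d step n by (simp add: walks_def cycle_colorings_def lessThan_Suc_atMost)
    ultimately show "d \<in> ?R" by (intro UN_I[of "d 0"] UN_I[of "d l"]) auto
  next
    fix d assume "d \<in> ?R"
    then have d: "d \<in> {..l} \<rightarrow>\<^sub>E A" "\<And>i. i < l \<Longrightarrow> d (Suc i) \<noteq> t i (d i)" "t l (d l) \<noteq> d 0"
      by (auto simp: walks_def)
    show "d \<in> ?L"
    proof (rule cycle_coloringsI)
      fix i assume "i < n"
      then show "d (Suc i mod n) \<noteq> t i (d i)"
        using d(2)[of i] d(3) n by (cases "i = l") auto
    qed (use d n in \<open>simp add: lessThan_Suc_atMost\<close>)
  qed
  moreover have "card \<dots> = (\<Sum>x\<in>A. card (\<Union>z\<in>{z\<in>A. t l z \<noteq> x}. walks A t l x z))"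
    using assms(1) by (intro card_UN_disjoint) (auto simp: finite_walks, auto simp: walks_def)
  moreover have "card (\<Union>z\<in>{z\<in>A. t l z \<noteq> x}. walks A t l x z) = card (walks A t n x x)"
    if "x \<in> A" for x
  proof -
    have "card (\<Union>z\<in>{z\<in>A. t l z \<noteq> x}. walks A t l x z)
        = (\<Sum>z\<in>{z\<in>A. t l z \<noteq> x}. card (walks A t l x z))"
      using assms(1) by (intro card_UN_disjoint) (auto simp: finite_walks, auto simp: walks_def)
    then show ?thesis using card_walks_Suc[OF assms(1) that] n by simp
  qed
  ultimately show ?thesis by simp
qed

text \<open>Every start color contributes the generic count of closed walks, and each fixed point of
  the monodromy adds \<open>(- 1) ^ n\<close>; the closed form then removes the walk number.\<close>

lemma card_cycle_colorings:
  assumes "finite A" "card A = k" "n \<ge> 2" "\<And>i. i < n \<Longrightarrow> bij_betw (t i) A A"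
  shows "int (card (cycle_colorings n A t))
           = (int k - 1) ^ n + (- 1) ^ n * (int (card {x\<in>A. monodromy t n x = x}) - 1)"
proof -
  have "int (card (cycle_colorings n A t))
      = (\<Sum>x\<in>A. walk_number k n + (if monodromy t n x = x then (- 1) ^ n else 0))"
    unfolding card_cycle_colorings_eq_sum[OF assms(1,3)] of_nat_sum
    by (rule sum.cong) (simp_all add: card_walks[OF assms(1,2,4)])
  also have "\<dots> = int k * walk_number k n + int (card {x\<in>A. monodromy t n x = x}) * (- 1) ^ n"
    using assms(1,2) by (simp add: sum.distrib sum.If_cases Int_def)
  finally show ?thesis using walk_number_closed_form[of k n] by (simp add: algebra_simps)
qed

text \<open>Cyclic relabeling of the positions is injective, so no shift lowers the count, and the
  opposite shift gives the reverse inequality.\<close>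

lemma card_cycle_colorings_rotate:
  assumes "finite A" "n \<ge> 1"
  shows "card (cycle_colorings n A (\<lambda>i. t ((i + s) mod n))) = card (cycle_colorings n A t)"
proof -
  have shift: "((i + (n - s mod n)) mod n + s) mod n = i" if "i < n" for i s
  proof -
    have "n - s mod n + s mod n = n" using assms(2) by (simp add: less_imp_le)
    then have "i + (n - s mod n) + s mod n = i + n" by simp
    moreover have "((i + (n - s mod n)) mod n + s) mod n = (i + (n - s mod n) + s mod n) mod n"
      by (metis mod_add_left_eq mod_add_right_eq)
    ultimately show ?thesis using that by simp
  qed
  define r where "r = (\<lambda>s (d :: nat \<Rightarrow> 'a). restrict (\<lambda>i. d ((i + s) mod n)) {..<n})"
  have le: "card (cycle_colorings n A t) \<le> card (cycle_colorings n A (\<lambda>i. t ((i + s) mod n)))" for t s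
  proof (rule card_inj_on_le)
    show "finite (cycle_colorings n A (\<lambda>i. t ((i + s) mod n)))"
      using assms(1) by (rule finite_cycle_colorings)
    show "inj_on (r s) (cycle_colorings n A t)"
    proof (rule inj_onI)
      fix c d assume c: "c \<in> cycle_colorings n A t" and d: "d \<in> cycle_colorings n A t"
        and eq: "r s c = r s d"
      have "c i = d i" if "i < n" for i
      proof -
        define j where "j = (i + (n - s mod n)) mod n"
        have "(j + s) mod n = i" unfolding j_def using that by (rule shift)
        moreover have "j < n" using assms(2) by (simp add: j_def)
        ultimately show ?thesis using fun_cong[OF eq, of j] by (simp add: r_def)
      qed
      then show "c = d" using cycle_colorings_ext[OF c d] by blast
    qed
    show "r s ` cycle_colorings n A t \<subseteq> cycle_colorings n A (\<lambda>i. t ((i + s) mod n))"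
    proof (rule image_subsetI)
      fix d assume d: "d \<in> cycle_colorings n A t"
      have lt: "i mod n < n" for i using assms(2) by simp
      have "d (Suc ((i + s) mod n) mod n) \<noteq> t ((i + s) mod n) (d ((i + s) mod n))" for i
        using cycle_colorings_step[OF d lt] .
      moreover have "Suc ((i + s) mod n) mod n = (Suc i mod n + s) mod n" for i
        by (simp add: mod_simps)
      ultimately show "r s d \<in> cycle_colorings n A (\<lambda>i. t ((i + s) mod n))"
        using cycle_colorings_mem[OF d] lt by (intro cycle_coloringsI) (auto simp: r_def)
    qed
  qed
  show ?thesis
  proof (rule antisym)
    define s' where "s' = n - s mod n"
    have *: "((i + s') mod n + s) mod n = i" if "i < n" for i
      unfolding s'_def using that by (rule shift)
    have "cycle_colorings n A (\<lambda>i. t (((i + s') mod n + s) mod n)) = cycle_colorings n A t"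
      by (auto simp: cycle_colorings_def *)
    then show "card (cycle_colorings n A (\<lambda>i. t ((i + s) mod n))) \<le> card (cycle_colorings n A t)"
      using le[of "\<lambda>i. t ((i + s) mod n)" s'] by simp
  qed (rule le)
qed

text \<open>The first return map of \<open>f\<close> to the complement of \<open>j\<close>.\<close>

definition bypass :: "'b \<Rightarrow> ('b \<Rightarrow> 'b) \<Rightarrow> 'b \<Rightarrow> 'b" where
  "bypass j f x = (if f x = j then f j else f x)"

text \<open>If \<open>f x = j\<close> with \<open>x \<noteq> j\<close>, then
  \<open>f j \<noteq> j\<close> by injectivity, so the detour through \<open>j\<close> stays in
  \<open>W - {j}\<close>. An injective self-map of a finite set is onto.\<close>

lemma bij_betw_bypass:
  assumes "finite W" "bij_betw f W W" "j \<in> W"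
  shows "bij_betw (bypass j f) (W - {j}) (W - {j})"
proof -
  have inj: "x = y" if "f x = f y" "x \<in> W" "y \<in> W" for x y
    using assms(2) that by (auto simp: bij_betw_def inj_on_def)
  have mem: "f x \<in> W" if "x \<in> W" for x using assms(2) that by (auto simp: bij_betw_def)
  have "bypass j f x \<in> W - {j}" if "x \<in> W - {j}" for x
    using inj[of x j] mem[of x] mem[of j] that assms(3) by (auto simp: bypass_def)
  moreover have "inj_on (bypass j f) (W - {j})"
  proof (rule inj_onI)
    fix x y assume "x \<in> W - {j}" "y \<in> W - {j}" "bypass j f x = bypass j f y"
    then show "x = y"
      using inj[of x y] inj[of x j] inj[of j y] assms(3) by (auto simp: bypass_def split: if_splits)
  qed
  ultimately show ?thesis
    using assms(1) by (simp add: bij_betw_def endo_inj_surj image_subset_iff)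
qed

lemma bypass_avoids: "y \<noteq> j \<Longrightarrow> y \<noteq> bypass j f x \<Longrightarrow> y \<noteq> f x"
  by (auto simp: bypass_def)

lemma monodromy_fixed: "(\<And>i. i < l \<Longrightarrow> t i x = x) \<Longrightarrow> monodromy t l x = x"
  by (induction l) auto

text \<open>Where \<open>s i\<close> hits \<open>j\<close>, the conflict disappears together with
  the color \<open>j\<close>, and the bypass puts another one in its place. This may lose colorings
  but restores permutations, for which the count is exact.\<close>

lemma cycle_colorings_bypass_subset:
  "cycle_colorings n (W - {j}) (\<lambda>i. bypass j (s i)) \<subseteq> cycle_colorings n (W - {j}) s"
proof
  fix d assume d: "d \<in> cycle_colorings n (W - {j}) (\<lambda>i. bypass j (s i))"
  have "d (Suc i mod n) \<noteq> s i (d i)" if "i < n" for i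
  proof (rule bypass_avoids[of _ j "s i"])
    have "Suc i mod n < n" using that by simp
    then show "d (Suc i mod n) \<noteq> j" using cycle_colorings_mem[OF d] by blast
  qed (rule cycle_colorings_step[OF d that])
  then show "d \<in> cycle_colorings n (W - {j}) s"
    using d by (simp add: cycle_colorings_def)
qed

text \<open>A common fixed point other than \<open>j\<close> is fixed by every bypass, hence by the
  monodromy. For even \<open>n\<close> each fixed point raises the exact count of the bypassed
  system by one.\<close>

lemma card_cycle_colorings_delete_ge:
  assumes W: "finite W" "card W = Suc k" "j \<in> W" and n: "n \<ge> 2" "even n"
    and s: "\<And>i. i < n \<Longrightarrow> bij_betw (s i) W W"
    and F: "F \<subseteq> W" "\<And>x i. x \<in> F \<Longrightarrow> i < n \<Longrightarrow> s i x = x"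
  shows "(int k - 1) ^ n - 1 + int (card (F - {j})) \<le> int (card (cycle_colorings n (W - {j}) s))"
proof -
  define t where "t = (\<lambda>i. bypass j (s i))"
  have "F - {j} \<subseteq> {x \<in> W - {j}. monodromy t n x = x}"
    using F by (auto simp: t_def bypass_def intro!: monodromy_fixed)
  then have "card (F - {j}) \<le> card {x \<in> W - {j}. monodromy t n x = x}"
    using W(1) by (intro card_mono) auto
  moreover have "int (card (cycle_colorings n (W - {j}) t))
      = (int k - 1) ^ n + (int (card {x \<in> W - {j}. monodromy t n x = x}) - 1)"
    using card_cycle_colorings[of "W - {j}" k n t] bij_betw_bypass[OF W(1) s W(3)] W n
    by (simp add: t_def)
  moreover have "card (cycle_colorings n (W - {j}) t) \<le> card (cycle_colorings n (W - {j}) s)"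
    unfolding t_def using W(1)
    by (intro card_mono cycle_colorings_bypass_subset) (simp add: finite_cycle_colorings)
  ultimately show ?thesis by linarith
qed

text \<open>If the last permutation moves \<open>j\<close>, then closing up the walks from \<open>s l j\<close> to the preimage of
  \<open>j\<close> gives colorings that violate the bypassed system only. When these are one fewer than generic,
  \<open>s l j\<close> is an additional fixed point of the monodromy, so the two effects cancel.\<close>

lemma card_cycle_colorings_delete_moved_last_ge:
  assumes W: "finite W" "card W = Suc k" "j \<in> W" and l: "odd l"
    and s: "\<And>i. i \<le> l \<Longrightarrow> bij_betw (s i) W W"
    and F: "F \<subseteq> W" "\<And>x i. x \<in> F \<Longrightarrow> i \<le> l \<Longrightarrow> s i x = x"
    and j: "s l j \<noteq> j"
  shows "(int k - 1) ^ Suc l - 1 + int (card F) + walk_number k l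
           \<le> int (card (cycle_colorings (Suc l) (W - {j}) s))"
proof -
  define A where "A = W - {j}"
  define t where "t = (\<lambda>i. bypass j (s i))"
  have A: "finite A" "card A = k" using W by (auto simp: A_def)
  have t: "bij_betw (t i) A A" if "i \<le> l" for i
    unfolding t_def A_def using bij_betw_bypass[OF W(1) s[OF that] W(3)] .
  have sl: "bij_betw (s l) W W" using s by simp
  \<comment> \<open>After \<open>a\<close> the bypass forbids \<open>b\<close>, whereas
    \<open>s l\<close> forbids only the deleted color \<open>j\<close>. Walks from \<open>b\<close>
    to \<open>a\<close> exploit this missing conflict.\<close>
  obtain a where a: "a \<in> W" "s l a = j" using sl W(3) by (metis bij_betw_imp_surj_on imageE)
  define b where "b = s l j"
  have aA: "a \<in> A" using a j by (auto simp: A_def)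
  have bA: "b \<in> A" using sl j W(3) by (auto simp: A_def b_def bij_betw_def)
  have tla: "t l a = b" using a by (simp add: t_def bypass_def b_def)
  have bF: "b \<notin> F"
  proof
    assume "b \<in> F"
    then have "s l b = s l j" using F(2)[of b l] by (simp add: b_def)
    then show False
      using sl bA W(3) unfolding bij_betw_def A_def by (auto dest: inj_onD)
  qed
  have jF: "j \<notin> F" using F(2)[of j l] j by auto
  define P where "P = {x \<in> A. monodromy t (Suc l) x = x}"
  have FP: "F \<subseteq> P"
  proof
    fix x assume x: "x \<in> F"
    then have "x \<noteq> j" using jF by auto
    moreover have "t i x = x" if "i < Suc l" for i
      using F(2)[OF x, of i] that \<open>x \<noteq> j\<close> by (simp add: t_def bypass_def)
    ultimately show "x \<in> P" unfolding P_def
      using x F(1) monodromy_fixed[of "Suc l" t x] by (auto simp: A_def)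
  qed
  have finP: "finite P" using A by (simp add: P_def)
  define X where "X = cycle_colorings (Suc l) A t"
  define Y where "Y = walks A t l b a"
  have cX: "int (card X) = (int k - 1) ^ Suc l + int (card P) - 1"
    unfolding X_def P_def using card_cycle_colorings[OF A, of "Suc l" t] t l
    by (cases l) auto
  \<comment> \<open>The correction is negative because \<open>l\<close> is odd.\<close>
  have cY: "int (card Y) = walk_number k l - (if monodromy t l b = a then 1 else 0)"
    unfolding Y_def using card_walks[OF A, of l t b a] t aA bA l by simp
  have FPY: "int (card F) \<le> int (card P) - (if monodromy t l b = a then 1 else 0)"
  proof (cases "monodromy t l b = a")
    case True
    then have "insert b F \<subseteq> P" using FP bA tla by (simp add: P_def)
    then have "card (insert b F) \<le> card P" using finP by (rule card_mono[rotated])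
    then show ?thesis using True bF finite_subset[OF FP finP] by simp
  next
    case False
    then show ?thesis using card_mono[OF finP FP] by simp
  qed
  have "Y \<subseteq> cycle_colorings (Suc l) A s"
  proof
    fix d assume "d \<in> Y"
    then have d: "d \<in> {..l} \<rightarrow>\<^sub>E A" "d 0 = b" "d l = a" "\<And>i. i < l \<Longrightarrow> d (Suc i) \<noteq> t i (d i)"
      by (auto simp: Y_def walks_def)
    show "d \<in> cycle_colorings (Suc l) A s"
    proof (rule cycle_coloringsI)
      fix i assume i: "i < Suc l"
      show "d (Suc i mod Suc l) \<noteq> s i (d i)"
      proof (cases "i = l")
        case True
        then show ?thesis using d a j by (simp add: b_def)
      next
        case False
        then have "Suc i \<le> l" using i by simp
        then have "d (Suc i) \<in> A" using d(1) by (auto simp: PiE_iff)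
        then have "d (Suc i) \<noteq> s i (d i)"
          using d(4)[of i] \<open>Suc i \<le> l\<close> by (intro bypass_avoids[of _ j "s i"]) (auto simp: A_def t_def)
        then show ?thesis using \<open>Suc i \<le> l\<close> by simp
      qed
    qed (use d in \<open>simp add: lessThan_Suc_atMost\<close>)
  qed
  moreover have "X \<subseteq> cycle_colorings (Suc l) A s"
    unfolding X_def A_def t_def by (rule cycle_colorings_bypass_subset)
  ultimately have "card (X \<union> Y) \<le> card (cycle_colorings (Suc l) A s)"
    using A by (intro card_mono) (auto simp: finite_cycle_colorings)
  \<comment> \<open>Colorings in \<open>X\<close> respect the conflict from \<open>a\<close> to
    \<open>b\<close> on the closing edge, while every walk in \<open>Y\<close> violates it.\<close>
  moreover have "X \<inter> Y = {}"
  proof -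
    have "d 0 \<noteq> t l (d l)" if "d \<in> X" for d
      using cycle_colorings_step[of d "Suc l" A t l] that by (simp add: X_def)
    then show ?thesis using tla by (auto simp: Y_def walks_def)
  qed
  then have "card (X \<union> Y) = card X + card Y"
    using A by (intro card_Un_disjoint) (auto simp: X_def Y_def finite_cycle_colorings finite_walks)
  ultimately show ?thesis using cX cY FPY unfolding A_def by linarith
qed

lemma card_cycle_colorings_delete_moved_ge:
  assumes W: "finite W" "card W = Suc k" "j \<in> W" and n: "n \<ge> 2" "even n"
    and s: "\<And>i. i < n \<Longrightarrow> bij_betw (s i) W W"
    and F: "F \<subseteq> W" "\<And>x i. x \<in> F \<Longrightarrow> i < n \<Longrightarrow> s i x = x"
    and j: "i0 < n" "s i0 j \<noteq> j"
  shows "(int k - 1) ^ n - 1 + int (card F) + walk_number k (n - 1)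
           \<le> int (card (cycle_colorings n (W - {j}) s))"
proof -
  obtain l where l: "n = Suc l" "odd l" using n by (cases n) auto
  \<comment> \<open>The offset is \<open>Suc i0\<close>, since the last index
    \<open>l = n - 1\<close> plus this offset is \<open>i0\<close> modulo \<open>n\<close>: an edge
    that moves \<open>j\<close> becomes the last one.\<close>
  define s' where "s' = (\<lambda>i. s ((i + Suc i0) mod n))"
  have lt: "i mod n < n" for i using n by simp
  have "l + Suc i0 = i0 + n" using l by simp
  then have "(l + Suc i0) mod n = i0" using j(1) by (metis mod_add_self2 mod_less)
  then have "s' l j \<noteq> j" using j(2) by (simp add: s'_def)
  then have "(int k - 1) ^ Suc l - 1 + int (card F) + walk_number k l
      \<le> int (card (cycle_colorings (Suc l) (W - {j}) s'))"
    using F s lt by (intro card_cycle_colorings_delete_moved_last_ge[OF W l(2)]) (auto simp: s'_def)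
  moreover have "card (cycle_colorings n (W - {j}) s') = card (cycle_colorings n (W - {j}) s)"
    unfolding s'_def using W n by (intro card_cycle_colorings_rotate) auto
  ultimately show ?thesis using l by simp
qed

text \<open>For odd \<open>l\<close> the closed form reads
  \<open>k * walk_number k l = (k - 1) ^ l + 1\<close>, and \<open>(k - 1) ^ 3 + 1 - k * k\<close>
  factors as \<open>k * ((k - 1) * (k - 3))\<close>, which is nonnegative from \<open>k = 3\<close>
  on.\<close>

lemma walk_number_ge:
  assumes "k \<ge> 3" "odd l" "l \<ge> 3"
  shows "k \<le> walk_number k l"
proof -
  have "k * k \<le> (k - 1) ^ 3 + 1"
  proof -
    have "(k - 1) ^ 3 + 1 - k * k = k * ((k - 1) * (k - 3))"
      by (simp add: power3_eq_cube algebra_simps)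
    moreover have "0 \<le> k * ((k - 1) * (k - 3))" using assms(1) by simp
    ultimately show ?thesis by linarith
  qed
  also have "(k - 1) ^ 3 \<le> (k - 1) ^ l" using assms by (intro power_increasing) auto
  finally have "k * k \<le> k * walk_number k l"
    using walk_number_closed_form[of k l] assms(2) by simp
  then show ?thesis using assms(1) by simp
qed

text \<open>The summand for \<open>j\<close> serves the rim colorings under apex color
  \<open>j\<close>. For even \<open>n\<close>, colors in \<open>F\<close> fall short of
  \<open>q\<close> by at most one and the others exceed it by at least \<open>k\<close>; for odd
  \<open>n\<close> every summand obeys the bound by itself.\<close>

lemma sum_card_cycle_colorings_delete_ge:
  assumes W: "finite W" "card W = Suc k" and n: "n \<ge> 3" and k: "k \<ge> 3"
    and s: "\<And>i. i < n \<Longrightarrow> bij_betw (s i) W W"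
  shows "int (Suc k) * ((int k - 1) ^ n + (- 1) ^ n * (int k - 1))
           \<le> (\<Sum>j\<in>W. int (card (cycle_colorings n (W - {j}) s)))"
proof (cases "even n")
  case True
  \<comment> \<open>An even \<open>n\<close> is at least 4, so the walks have length
    \<open>n - 1 \<ge> 3\<close>, as the estimate of the walk number requires.\<close>
  then have n4: "n \<ge> 4" using n by (cases "n = 3") auto
  define F where "F = {x \<in> W. \<forall>i<n. s i x = x}"
  define q where "q = (int k - 1) ^ n - 1 + int (card F)"
  have FW: "F \<subseteq> W" and finF: "finite F" using W by (auto simp: F_def)
  have fix_F: "s i x = x" if "x \<in> F" "i < n" for x i using that by (simp add: F_def)
  have wn: "int k \<le> walk_number k (n - 1)" using k n4 True by (intro walk_number_ge) auto
  have "(\<Sum>j\<in>W. if j \<in> F then q - 1 else q + int k)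
      \<le> (\<Sum>j\<in>W. int (card (cycle_colorings n (W - {j}) s)))"
  proof (rule sum_mono)
    fix j assume j: "j \<in> W"
    show "(if j \<in> F then q - 1 else q + int k) \<le> int (card (cycle_colorings n (W - {j}) s))"
    proof (cases "j \<in> F")
      case jF: True
      then have "card F > 0" using finF by (auto simp: card_gt_0_iff)
      then have "int (card (F - {j})) = int (card F) - 1" using jF finF by (simp add: of_nat_diff)
      moreover have "(int k - 1) ^ n - 1 + int (card (F - {j}))
          \<le> int (card (cycle_colorings n (W - {j}) s))"
        using n True s FW fix_F by (intro card_cycle_colorings_delete_ge[OF W j]) auto
      ultimately show ?thesis using jF by (simp add: q_def)
    next
      case False
      then obtain i0 where i0: "i0 < n" "s i0 j \<noteq> j" using j by (auto simp: F_def)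
      have "(int k - 1) ^ n - 1 + int (card F) + walk_number k (n - 1)
          \<le> int (card (cycle_colorings n (W - {j}) s))"
        using n True s FW fix_F i0 by (intro card_cycle_colorings_delete_moved_ge[OF W j]) auto
      then show ?thesis using wn False by (simp add: q_def)
    qed
  qed
  moreover have "(\<Sum>j\<in>W. if j \<in> F then q - 1 else q + int k)
      = int (card F) * (q - 1) + int (card (W - F)) * (q + int k)"
  proof -
    have "W \<inter> {x. x \<in> F} = F" "W \<inter> - {x. x \<in> F} = W - F" using FW by auto
    then show ?thesis using W(1) by (simp add: sum.If_cases)
  qed
  moreover have "int (card (W - F)) = int (Suc k) - int (card F)"
    using card_Diff_subset[OF finF FW] card_mono[OF W(1) FW] W(2) by (simp add: of_nat_diff)
  \<comment> \<open>The size of \<open>F\<close> cancels: it enters through \<open>q\<close> with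
    factor \<open>k + 1\<close> and through the number of summands of either kind with factor
    \<open>- (k + 1)\<close>.\<close>
  moreover have "int (card F) * (q - 1) + (int (Suc k) - int (card F)) * (q + int k)
      = int (Suc k) * ((int k - 1) ^ n + (int k - 1))"
    by (simp add: q_def algebra_simps)
  ultimately show ?thesis using True by simp
next
  case False
  \<comment> \<open>For odd \<open>n\<close> fixed points count negatively, and the worst case is
    that all \<open>k\<close> colors are fixed.\<close>
  have "(\<Sum>j\<in>W. (int k - 1) ^ n - (int k - 1))
      \<le> (\<Sum>j\<in>W. int (card (cycle_colorings n (W - {j}) s)))"
  proof (rule sum_mono)
    fix j assume j: "j \<in> W"
    define t where "t = (\<lambda>i. bypass j (s i))"
    define P where "P = {x \<in> W - {j}. monodromy t n x = x}"
    have "int (card (cycle_colorings n (W - {j}) t)) = (int k - 1) ^ n - (int (card P) - 1)"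
      unfolding P_def
      using card_cycle_colorings[of "W - {j}" k n t] bij_betw_bypass[OF W(1) s j] W n False j
      by (simp add: t_def)
    moreover have "card P \<le> card (W - {j})" using W by (intro card_mono) (auto simp: P_def)
    then have "card P \<le> k" using W j by simp
    moreover have "card (cycle_colorings n (W - {j}) t) \<le> card (cycle_colorings n (W - {j}) s)"
      unfolding t_def using W(1)
      by (intro card_mono cycle_colorings_bypass_subset) (simp add: finite_cycle_colorings)
    ultimately show "(int k - 1) ^ n - (int k - 1) \<le> int (card (cycle_colorings n (W - {j}) s))"
      by linarith
  qed
  then show ?thesis using False W by (simp add: algebra_simps)
qed

section \<open>Deleting a vertex from a system\<close>

lemma system_colorings_mono:
  "(\<And>v. v \<in> V \<Longrightarrow> L v \<subseteq> L' v) \<Longrightarrow> system_colorings V L E \<subseteq> system_colorings V L' E"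
  unfolding system_colorings_def PiE_iff by blast

lemma system_colorings_cong:
  assumes "\<And>v. v \<in> V \<Longrightarrow> L v = L' v"
  shows "system_colorings V L E = system_colorings V L' E"
  using assms by (intro equalityI system_colorings_mono) auto

text \<open>Once \<open>w\<close> has color \<open>x\<close>, its conflicts only shorten the other
  lists; symmetry covers both orders of each pair.\<close>

lemma card_system_colorings_insert:
  assumes "finite V" "w \<notin> V" "\<And>u. u \<in> insert w V \<Longrightarrow> finite (L u)"
    and sym: "\<And>u v x y. E u v x y \<Longrightarrow> E v u y x"
  shows "card (system_colorings (insert w V) L E)
           = (\<Sum>x\<in>L w. card (system_colorings V (\<lambda>v. {y \<in> L v. \<not> E w v x y}) E))"
proof -
  let ?R = "\<lambda>x. system_colorings V (\<lambda>v. {y \<in> L v. \<not> E w v x y}) E"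
  have "bij_betw (\<lambda>c. (c w, restrict c V)) (system_colorings (insert w V) L E) (SIGMA x:L w. ?R x)"
  proof (rule bij_betw_byWitness[where f' = "\<lambda>(x, c). c(w := x)"])
    show "\<forall>c\<in>system_colorings (insert w V) L E. (\<lambda>(x, c). c(w := x)) (c w, restrict c V) = c"
      by (auto simp: system_colorings_def PiE_iff extensional_def fun_eq_iff)
    show "\<forall>p\<in>SIGMA x:L w. ?R x. (\<lambda>c. (c w, restrict c V)) ((\<lambda>(x, c). c(w := x)) p) = p"
      using assms(2) by (auto simp: system_colorings_def PiE_iff extensional_def fun_eq_iff)
    show "(\<lambda>c. (c w, restrict c V)) ` system_colorings (insert w V) L E \<subseteq> (SIGMA x:L w. ?R x)"
      using assms(2) by (auto simp: system_colorings_def PiE_iff)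
    show "(\<lambda>(x, c). c(w := x)) ` (SIGMA x:L w. ?R x) \<subseteq> system_colorings (insert w V) L E"
    proof (clarify)
      fix x c assume x: "x \<in> L w" and c: "c \<in> ?R x"
      have cv: "c v \<in> L v" "\<not> E w v x (c v)" "\<not> E v w (c v) x" if "v \<in> V" for v
        using system_colorings_mem[OF c that] sym by blast+
      have "(c(w := x)) u \<in> L u" if "u \<in> insert w V" for u using cv x that by auto
      moreover have "\<not> E u v ((c(w := x)) u) ((c(w := x)) v)"
        if "u \<in> insert w V" "v \<in> insert w V" "u \<noteq> v" for u v
        using that cv system_colorings_conflict_free[OF c, of u v] by auto
      moreover have "c(w := x) \<in> extensional (insert w V)"
        using c by (auto simp: system_colorings_def PiE_iff extensional_def)
      ultimately show "c(w := x) \<in> system_colorings (insert w V) L E"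
        unfolding system_colorings_def PiE_iff by blast
    qed
  qed
  then have "card (system_colorings (insert w V) L E) = card (SIGMA x:L w. ?R x)"
    by (rule bij_betw_same_card)
  also have "\<dots> = (\<Sum>x\<in>L w. card (?R x))"
    using assms(1,3) by (intro card_SigmaI) (auto intro!: finite_system_colorings)
  finally show ?thesis .
qed

text \<open>By the matching property a color of \<open>w\<close> conflicts with at most one color of
  each other list, so at least \<open>k\<close> survive there.\<close>

lemma card_system_colorings_insert_ge:
  assumes V: "finite V" "w \<notin> V" and E: "matching_system G E"
    and L: "\<And>u. u \<in> insert w V \<Longrightarrow> card (L u) = Suc k"
    and bound: "\<And>L'. (\<And>u. u \<in> V \<Longrightarrow> card (L' u) = k) \<Longrightarrow> b \<le> int (card (system_colorings V L' E))"
  shows "int (Suc k) * b \<le> int (card (system_colorings (insert w V) L E))"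
proof -
  have finL: "finite (L u)" if "u \<in> insert w V" for u using L[OF that] card.infinite by fastforce
  have "b \<le> int (card (system_colorings V (\<lambda>v. {y \<in> L v. \<not> E w v x y}) E))" for x
  proof -
    have "k \<le> card {y \<in> L v. \<not> E w v x y}" if v: "v \<in> V" for v
    proof -
      have "\<forall>y\<in>{y \<in> L v. E w v x y}. \<forall>y'\<in>{y \<in> L v. E w v x y}. y = y'"
        using E unfolding matching_system_def by blast
      moreover have "finite {y \<in> L v. E w v x y}" using finL[of v] v by simp
      ultimately have "card {y \<in> L v. E w v x y} \<le> 1" by (simp add: card_le_Suc0_iff_eq)
      moreover have "card (L v) = card ({y \<in> L v. \<not> E w v x y} \<union> {y \<in> L v. E w v x y})"
        by (rule arg_cong[of _ _ card]) auto
      then have "Suc k \<le> card {y \<in> L v. \<not> E w v x y} + card {y \<in> L v. E w v x y}"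
        using L[of v] v card_Un_le by (metis insertI2)
      ultimately show ?thesis by simp
    qed
    \<comment> \<open>Some lists may keep all \<open>Suc k\<close> colors; cutting every list to
      exactly \<open>k\<close> only loses colorings and lets \<open>bound\<close> apply.\<close>
    then have "\<exists>B. B \<subseteq> {y \<in> L v. \<not> E w v x y} \<and> card B = k" if "v \<in> V" for v
      using that by (meson obtain_subset_with_card_n)
    then obtain L' where L': "\<And>v. v \<in> V \<Longrightarrow> L' v \<subseteq> {y \<in> L v. \<not> E w v x y} \<and> card (L' v) = k"
      by metis
    have "b \<le> int (card (system_colorings V L' E))" using bound L' by blast
    also have "card (system_colorings V L' E)
        \<le> card (system_colorings V (\<lambda>v. {y \<in> L v. \<not> E w v x y}) E)"
      using V(1) finL L' by (intro card_mono finite_system_colorings system_colorings_mono) auto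
    finally show ?thesis by simp
  qed
  then have "(\<Sum>x\<in>L w. b) \<le> (\<Sum>x\<in>L w. int (card (system_colorings V (\<lambda>v. {y \<in> L v. \<not> E w v x y}) E)))"
    by (intro sum_mono) auto
  moreover have "E v u y x" if "E u v x y" for u v x y
    using E that by (auto simp: matching_system_def)
  then have "card (system_colorings (insert w V) L E)
           = (\<Sum>x\<in>L w. card (system_colorings V (\<lambda>v. {y \<in> L v. \<not> E w v x y}) E))"
    using V finL by (intro card_system_colorings_insert) auto
  ultimately show ?thesis using L[of w] by simp
qed

text \<open>The unmatched parts of \<open>A\<close> and \<open>B\<close> have equal size, so any
  bijection between them completes the matching. Extra conflicts only lose colorings, so a lower
  bound may work with bijections.\<close>

lemma matching_extends_to_bij:
  assumes fin: "finite A" "finite B" and card: "card A = card B"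
    and fn: "\<And>x y y'. R x y \<Longrightarrow> R x y' \<Longrightarrow> y = y'" and inj: "\<And>x x' y. R x y \<Longrightarrow> R x' y \<Longrightarrow> x = x'"
  shows "\<exists>h. bij_betw h A B \<and> (\<forall>x\<in>A. \<forall>y\<in>B. R x y \<longrightarrow> h x = y)"
proof -
  define A1 where "A1 = {x \<in> A. \<exists>y\<in>B. R x y}"
  define g where "g = (\<lambda>x. SOME y. y \<in> B \<and> R x y)"
  have g: "g x \<in> B \<and> R x (g x)" if "x \<in> A1" for x
    unfolding g_def by (rule someI_ex) (use that in \<open>auto simp: A1_def\<close>)
  have "inj_on g A1"
  proof (rule inj_onI)
    fix x y assume "x \<in> A1" "y \<in> A1" "g x = g y"
    then show "x = y" using g[of x] g[of y] inj[of x "g x" y] by simp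
  qed
  then have g_bij: "bij_betw g A1 (g ` A1)" by (simp add: bij_betw_def)
  have A1: "A1 \<subseteq> A" "finite A1" and B1: "g ` A1 \<subseteq> B" "finite (g ` A1)"
    using g fin by (auto simp: A1_def)
  have "card (A - A1) = card (B - g ` A1)"
    using card \<open>inj_on g A1\<close> A1 B1 by (simp add: card_Diff_subset card_image)
  then obtain h0 where h0: "bij_betw h0 (A - A1) (B - g ` A1)"
    using fin by (meson finite_Diff finite_same_card_bij)
  define h where "h = (\<lambda>x. if x \<in> A1 then g x else h0 x)"
  have "bij_betw h A1 (g ` A1)" using g_bij by (rule bij_betw_cong[THEN iffD1, rotated]) (simp add: h_def)
  moreover have "bij_betw h (A - A1) (B - g ` A1)"
    using h0 by (rule bij_betw_cong[THEN iffD1, rotated]) (simp add: h_def)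
  ultimately have "bij_betw h (A1 \<union> (A - A1)) (g ` A1 \<union> (B - g ` A1))"
    by (rule bij_betw_combine) auto
  moreover have "A1 \<union> (A - A1) = A" "g ` A1 \<union> (B - g ` A1) = B" using A1 B1 by auto
  ultimately have "bij_betw h A B" by simp
  moreover have "h x = y" if "x \<in> A" "y \<in> B" "R x y" for x y
  proof -
    have "x \<in> A1" using that by (auto simp: A1_def)
    then show ?thesis using g[of x] that fn[of x "g x" y] by (simp add: h_def)
  qed
  ultimately show ?thesis by blast
qed

section \<open>The join of a complete graph and a cycle\<close>

abbreviation cone_graph :: "nat \<Rightarrow> nat \<Rightarrow> (nat + nat) ugraph" where
  "cone_graph p n \<equiv> graph_join (complete_graph p) (cycle_graph n)"

text \<open>Kept apart from the graph, so that apex vertices can be deleted while the conflicts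
  remain those of the full join.\<close>

definition cone_verts :: "nat \<Rightarrow> nat \<Rightarrow> (nat + nat) set" where
  "cone_verts p n = Inl ` {..<p} \<union> Inr ` {..<n}"

lemma uverts_cone: "uverts (cone_graph p n) = cone_verts p n"
  by (simp add: graph_join_def complete_graph_def cycle_graph_def cone_verts_def Plus_def)

lemma finite_cone_verts: "finite (cone_verts p n)"
  by (simp add: cone_verts_def)

lemma cone_verts_Suc: "cone_verts (Suc p) n = insert (Inl p) (cone_verts p n)"
  by (auto simp: cone_verts_def less_Suc_eq)

lemma Inl_notin_cone_verts: "Inl p \<notin> cone_verts p n"
  by (auto simp: cone_verts_def)

lemma join_edge_iff:
  "{Inl i, Inl j} \<in> uedges (graph_join G H) \<longleftrightarrow> {i, j} \<in> uedges G"
  "{Inr i', Inr j'} \<in> uedges (graph_join G H) \<longleftrightarrow> {i', j'} \<in> uedges H"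
  "{Inl i, Inr j'} \<in> uedges (graph_join G H) \<longleftrightarrow> i \<in> uverts G \<and> j' \<in> uverts H"
proof -
  have L: "{Inl i, Inl j} \<in> (image Inl) ` X \<longleftrightarrow> {i, j} \<in> X" for X :: "'a set set"
    using inj_image_mem_iff[of "image Inl" "{i, j}" X] by (simp add: inj_def inj_image_eq_iff)
  have R: "{Inr i', Inr j'} \<in> (image Inr) ` X \<longleftrightarrow> {i', j'} \<in> X" for X :: "'b set set"
    using inj_image_mem_iff[of "image Inr" "{i', j'}" X] by (simp add: inj_def inj_image_eq_iff)
  have nL: "e \<notin> (image Inl) ` X" if "Inr y \<in> e" for e :: "('a + 'b) set" and X y using that by auto
  have nR: "e \<notin> (image Inr) ` X" if "Inl x \<in> e" for e :: "('a + 'b) set" and X x using that by auto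
  show "{Inl i, Inl j} \<in> uedges (graph_join G H) \<longleftrightarrow> {i, j} \<in> uedges G"
    using nR[of i "{Inl i, Inl j}"] by (simp add: graph_join_def L doubleton_eq_iff)
  show "{Inr i', Inr j'} \<in> uedges (graph_join G H) \<longleftrightarrow> {i', j'} \<in> uedges H"
    using nL[of i' "{Inr i', Inr j'}"] by (simp add: graph_join_def R doubleton_eq_iff)
  show "{Inl i, Inr j'} \<in> uedges (graph_join G H) \<longleftrightarrow> i \<in> uverts G \<and> j' \<in> uverts H"
    using nR[of i "{Inl i, Inr j'}"] nL[of j' "{Inl i, Inr j'}"]
    by (simp add: graph_join_def doubleton_eq_iff)
qed

lemma cone_edge_iff:
  "{Inl i, Inl j} \<in> uedges (cone_graph p n) \<longleftrightarrow> i < p \<and> j < p \<and> i \<noteq> j"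
  "{Inl i, Inr j} \<in> uedges (cone_graph p n) \<longleftrightarrow> i < p \<and> j < n"
  "{Inr j, Inl i} \<in> uedges (cone_graph p n) \<longleftrightarrow> i < p \<and> j < n"
  "{Inr i, Inr j} \<in> uedges (cone_graph p n) \<longleftrightarrow> (i < n \<and> j = Suc i mod n) \<or> (j < n \<and> i = Suc j mod n)"
proof -
  show "{Inl i, Inl j} \<in> uedges (cone_graph p n) \<longleftrightarrow> i < p \<and> j < p \<and> i \<noteq> j"
    by (auto simp: join_edge_iff complete_graph_def nsets_def card_insert_if)
  show *: "{Inl i, Inr j} \<in> uedges (cone_graph p n) \<longleftrightarrow> i < p \<and> j < n"
    by (simp add: join_edge_iff complete_graph_def cycle_graph_def)
  then show "{Inr j, Inl i} \<in> uedges (cone_graph p n) \<longleftrightarrow> i < p \<and> j < n"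
    by (simp add: insert_commute)
  show "{Inr i, Inr j} \<in> uedges (cone_graph p n) \<longleftrightarrow>
      (i < n \<and> j = Suc i mod n) \<or> (j < n \<and> i = Suc j mod n)"
    by (auto simp: join_edge_iff cycle_graph_def doubleton_eq_iff)
qed

lemma simple_cone: "n \<ge> 3 \<Longrightarrow> simple_graph (cone_graph p n)"
  by (intro simple_graph_join simple_graph_complete simple_graph_cycle)

text \<open>Through the bijections \<open>h i\<close> the apex color \<open>j\<close> can exclude
  only \<open>j\<close> from the rim. Each pair of \<open>j\<close> and a rim coloring from
  \<open>W - {j}\<close> thus yields a coloring of the wheel, and the cycle counts can be summed
  over \<open>j\<close>.\<close>

lemma wheel_colorings_ge:
  assumes E: "matching_system (cone_graph p n) E" and n: "n \<ge> 3" and k: "k \<ge> 3"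
    and L: "\<And>u. u \<in> cone_verts 1 n \<Longrightarrow> card (L u) = Suc k"
  shows "int (Suc k) * ((int k - 1) ^ n + (- 1) ^ n * (int k - 1))
           \<le> int (card (system_colorings (cone_verts 1 n) L E))"
proof -
  define W where "W = L (Inl 0)"
  have sym: "E v u y x" if "E u v x y" for u v x y using E that unfolding matching_system_def by blast
  have fn: "y = y'" if "E u v x y" "E u v x y'" for u v x y y'
    using E that unfolding matching_system_def by blast
  have inj: "x = x'" if "E u v x y" "E u v x' y" for u v x x' y
    using fn[of v u y x x'] sym that by blast
  have EG: "{u, v} \<in> uedges (cone_graph p n)" if "E u v x y" for u v x y
    using E that unfolding matching_system_def by blast
  have V: "Inl 0 \<in> cone_verts 1 n" "\<And>i. i < n \<Longrightarrow> Inr i \<in> cone_verts 1 n"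
    by (auto simp: cone_verts_def)
  have finL: "finite (L u)" if "u \<in> cone_verts 1 n" for u using L[OF that] card.infinite by fastforce
  have W: "finite W" "card W = Suc k" using L finL V by (auto simp: W_def)
  have ext: "\<exists>h. bij_betw h (L u) (L v) \<and> (\<forall>x\<in>L u. \<forall>y\<in>L v. E u v x y \<longrightarrow> h x = y)"
    if "u \<in> cone_verts 1 n" "v \<in> cone_verts 1 n" for u v
    using that L finL by (intro matching_extends_to_bij) (auto intro: fn inj)
  have "\<forall>i\<in>{..<n}. \<exists>h. bij_betw h W (L (Inr i)) \<and>
      (\<forall>x\<in>W. \<forall>y\<in>L (Inr i). E (Inl 0) (Inr i) x y \<longrightarrow> h x = y)"
    unfolding W_def using ext V by simp
  from bchoice[OF this] obtain h where
    h: "\<And>i. i < n \<Longrightarrow> bij_betw (h i) W (L (Inr i))" and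
    hE: "\<And>i x y. i < n \<Longrightarrow> x \<in> W \<Longrightarrow> y \<in> L (Inr i) \<Longrightarrow> E (Inl 0) (Inr i) x y \<Longrightarrow> h i x = y"
    by blast
  have lt: "i mod n < n" for i using n by simp
  have "\<forall>i\<in>{..<n}. \<exists>f. bij_betw f (L (Inr i)) (L (Inr (Suc i mod n))) \<and>
      (\<forall>x\<in>L (Inr i). \<forall>y\<in>L (Inr (Suc i mod n)). E (Inr i) (Inr (Suc i mod n)) x y \<longrightarrow> f x = y)"
    using ext V lt by simp
  from bchoice[OF this] obtain f where
    f: "\<And>i. i < n \<Longrightarrow> bij_betw (f i) (L (Inr i)) (L (Inr (Suc i mod n)))" and
    fE: "\<And>i x y. i < n \<Longrightarrow> x \<in> L (Inr i) \<Longrightarrow> y \<in> L (Inr (Suc i mod n))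
           \<Longrightarrow> E (Inr i) (Inr (Suc i mod n)) x y \<Longrightarrow> f i x = y"
    by blast
  \<comment> \<open>\<open>s i\<close> is the rim bijection \<open>f i\<close> in the coordinates
    given by \<open>h\<close>.\<close>
  define s where "s = (\<lambda>i. inv_into W (h (Suc i mod n)) \<circ> (f i \<circ> h i))"
  have s: "bij_betw (s i) W W" if "i < n" for i
    unfolding s_def using bij_betw_trans[OF bij_betw_trans[OF h f] bij_betw_inv_into[OF h[OF lt]]] that
    by simp
  have hs: "h (Suc i mod n) (s i x) = f i (h i x)" if "i < n" "x \<in> W" for i x
  proof -
    have "f i (h i x) \<in> L (Inr (Suc i mod n))" using h f that by (meson bij_betwE)
    then show ?thesis
      using bij_betw_inv_into_right[OF h[OF lt]] by (simp add: s_def)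
  qed
  define g where "g = (\<lambda>(j, d). \<lambda>u\<in>cone_verts 1 n. case u of Inl _ \<Rightarrow> j | Inr i \<Rightarrow> h i (d i))"
  have g_simps: "g (j, d) (Inl 0) = j" "i < n \<Longrightarrow> g (j, d) (Inr i) = h i (d i)" for j d i
    using V by (auto simp: g_def)
  have h_inj: "x = y" if "h i x = h i y" "i < n" "x \<in> W" "y \<in> W" for i x y
    using h[OF that(2)] that unfolding bij_betw_def by (blast dest: inj_onD)
  have h_mem: "h i x \<in> L (Inr i)" if "i < n" "x \<in> W" for i x using h that by (meson bij_betwE)
  have "card (SIGMA j:W. cycle_colorings n (W - {j}) s) \<le> card (system_colorings (cone_verts 1 n) L E)"
  proof (rule card_inj_on_le)
    show "finite (system_colorings (cone_verts 1 n) L E)"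
      using finL by (intro finite_system_colorings finite_cone_verts)
    show "inj_on g (SIGMA j:W. cycle_colorings n (W - {j}) s)"
    proof (rule inj_onI, clarify)
      fix j d j' d' assume j: "j \<in> W" "j' \<in> W" and d: "d \<in> cycle_colorings n (W - {j}) s"
        and d': "d' \<in> cycle_colorings n (W - {j'}) s" and eq: "g (j, d) = g (j', d')"
      have "j = j'" using fun_cong[OF eq, of "Inl 0"] by (simp add: g_simps)
      moreover have "d i = d' i" if i: "i < n" for i
        using fun_cong[OF eq, of "Inr i"] cycle_colorings_mem[OF d i] cycle_colorings_mem[OF d' i] i
        by (auto simp: g_simps intro: h_inj)
      then have "d = d'" by (rule cycle_colorings_ext[OF d d'])
      ultimately show "j = j' \<and> d = d'" by simp
    qed
    show "g ` (SIGMA j:W. cycle_colorings n (W - {j}) s) \<subseteq> system_colorings (cone_verts 1 n) L E"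
    proof (rule image_subsetI, clarify)
      fix j d assume j: "j \<in> W" and d: "d \<in> cycle_colorings n (W - {j}) s"
      have dW: "d i \<in> W" "d i \<noteq> j" if "i < n" for i using cycle_colorings_mem[OF d that] by auto
      have apex: "\<not> E (Inl 0) (Inr i) j (h i (d i))" if "i < n" for i
        using hE[of i j "h i (d i)"] h_inj[of i j "d i"] h_mem[of i "d i"] dW[OF that] that j by auto
      have rim: "\<not> E (Inr i) (Inr (Suc i mod n)) (h i (d i)) (h (Suc i mod n) (d (Suc i mod n)))"
        if i: "i < n" for i
      proof
        assume "E (Inr i) (Inr (Suc i mod n)) (h i (d i)) (h (Suc i mod n) (d (Suc i mod n)))"
        then have "f i (h i (d i)) = h (Suc i mod n) (d (Suc i mod n))"
          using fE h_mem dW i lt by blast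
        then have "h (Suc i mod n) (s i (d i)) = h (Suc i mod n) (d (Suc i mod n))"
          using hs dW i by simp
        moreover have "s i (d i) \<in> W" using s[OF i] dW[OF i] by (auto simp: bij_betw_def)
        ultimately have "s i (d i) = d (Suc i mod n)"
          using h_inj[OF _ lt] dW[OF lt] by blast
        then show False using cycle_colorings_step[OF d i] by simp
      qed
      have "\<not> E u v (g (j, d) u) (g (j, d) v)"
        if u: "u \<in> cone_verts 1 n" and v: "v \<in> cone_verts 1 n" and uv: "u \<noteq> v" for u v
      proof
        assume con: "E u v (g (j, d) u) (g (j, d) v)"
        consider "u = Inl 0" "v = Inl 0" | i where "i < n" "u = Inl 0" "v = Inr i"
          | i where "i < n" "u = Inr i" "v = Inl 0"
          | i i' where "i < n" "i' < n" "u = Inr i" "v = Inr i'"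
          using u v by (auto simp: cone_verts_def)
        then show False
        proof cases
          case 1
          then show False using uv by simp
        next
          case 2
          then show False using con apex by (simp add: g_simps)
        next
          case 3
          then show False using sym[OF con] apex by (simp add: g_simps)
        next
          case 4
          then consider "i' = Suc i mod n" | "i = Suc i' mod n"
            using EG[OF con] by (auto simp: cone_edge_iff)
          then show False
          proof cases
            case 1
            then show False using con 4 rim[of i] by (simp add: g_simps)
          next
            case 2
            then show False using sym[OF con] 4 rim[of i'] by (simp add: g_simps)
          qed
        qed
      qed
      moreover have "g (j, d) u \<in> L u" if "u \<in> cone_verts 1 n" for u
        using that j h_mem dW by (auto simp: cone_verts_def g_simps W_def)
      moreover have "g (j, d) \<in> extensional (cone_verts 1 n)" by (simp add: g_def)
      ultimately show "g (j, d) \<in> system_colorings (cone_verts 1 n) L E"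
        unfolding system_colorings_def PiE_iff by blast
    qed
  qed
  moreover have "card (SIGMA j:W. cycle_colorings n (W - {j}) s)
      = (\<Sum>j\<in>W. card (cycle_colorings n (W - {j}) s))"
    using W by (intro card_SigmaI) (auto simp: finite_cycle_colorings)
  moreover have "int (Suc k) * ((int k - 1) ^ n + (- 1) ^ n * (int k - 1))
      \<le> (\<Sum>j\<in>W. int (card (cycle_colorings n (W - {j}) s)))"
    using W n k s by (intro sum_card_cycle_colorings_delete_ge) auto
  ultimately show ?thesis by (simp flip: of_nat_sum)
qed

text \<open>The value at \<open>p + k\<close> of the chromatic polynomial of the join.\<close>

definition cone_poly :: "nat \<Rightarrow> nat \<Rightarrow> nat \<Rightarrow> int" where
  "cone_poly p n k = (\<Prod>i<p. int (Suc (i + k))) * ((int k - 1) ^ n + (- 1) ^ n * (int k - 1))"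

lemma cone_poly_Suc: "cone_poly (Suc p) n k = int (Suc (p + k)) * cone_poly p n k"
  by (simp add: cone_poly_def)

text \<open>The induction starts at the wheel: for even \<open>n\<close> a rim alone can have a
  monodromy without fixed points, and its count then drops below the chromatic one.\<close>

lemma cone_colorings_ge:
  assumes E: "matching_system (cone_graph p' n) E" and n: "n \<ge> 3" and k: "k \<ge> 3" and p: "p \<ge> 1"
    and L: "\<And>u. u \<in> cone_verts p n \<Longrightarrow> card (L u) = p + k"
  shows "cone_poly p n k \<le> int (card (system_colorings (cone_verts p n) L E))"
  using p L
proof (induction p arbitrary: L rule: dec_induct)
  case base
  then show ?case
    using wheel_colorings_ge[OF E n k, of L] by (simp add: cone_poly_def)
next
  case (step p)
  have "int (Suc (p + k)) * cone_poly p n k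
      \<le> int (card (system_colorings (insert (Inl p) (cone_verts p n)) L E))"
    using step.prems
    by (intro card_system_colorings_insert_ge[OF finite_cone_verts Inl_notin_cone_verts E] step.IH)
      (auto simp: cone_verts_Suc)
  then show ?case by (simp add: cone_poly_Suc cone_verts_Suc)
qed

section \<open>The chromatic polynomial of the join\<close>

definition equality_system :: "'a ugraph \<Rightarrow> 'a \<Rightarrow> 'a \<Rightarrow> 'b \<Rightarrow> 'b \<Rightarrow> bool" where
  "equality_system G u v x y \<longleftrightarrow> {u, v} \<in> uedges G \<and> x = y"

lemma matching_equality_system: "matching_system G (equality_system G)"
  by (auto simp: matching_system_def equality_system_def insert_commute)

lemma proper_colorings_eq_system:
  assumes "simple_graph G"
  shows "proper_colorings G m = system_colorings (uverts G) (\<lambda>_. {..<m}) (equality_system G)"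
proof -
  have "u \<in> uverts G \<and> v \<in> uverts G \<and> u \<noteq> v" if "{u, v} \<in> uedges G" for u v
    using assms that by (auto simp: simple_graph_def nsets_def)
  then show ?thesis
    unfolding proper_colorings_def system_colorings_def equality_system_def by blast
qed

text \<open>A color chosen at the newest apex vertex leaves every other list, so the common list
  becomes \<open>A - {x}\<close>; this is why \<open>A\<close> is an arbitrary set. On the bare
  cycle all permutations are identities and all \<open>k\<close> colors are fixed.\<close>

lemma card_cone_colorings:
  assumes n: "n \<ge> 3" and p: "p \<le> p'" and A: "finite A" "card A = p + k"
  shows "int (card (system_colorings (cone_verts p n) (\<lambda>_. A) (equality_system (cone_graph p' n))))
           = cone_poly p n k"
  using p A
proof (induction p arbitrary: A)
  case 0
  let ?S = "system_colorings (cone_verts 0 n) (\<lambda>_. A) (equality_system (cone_graph p' n))"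
  have V: "cone_verts 0 n = Inr ` {..<n}" by (simp add: cone_verts_def)
  have lt: "i mod n < n" for i using n by simp
  have ne: "Suc i mod n \<noteq> i" if "i < n" for i
    using n that by (cases "Suc i = n") auto
  have "bij_betw (\<lambda>c. \<lambda>i\<in>{..<n}. c (Inr i)) ?S (cycle_colorings n A (\<lambda>_ x. x))"
  proof (rule bij_betw_byWitness[where f' = "\<lambda>d. \<lambda>u\<in>cone_verts 0 n. case u of Inr i \<Rightarrow> d i"])
    show "\<forall>c\<in>?S. (\<lambda>u\<in>cone_verts 0 n. case u of Inr i \<Rightarrow> (\<lambda>i\<in>{..<n}. c (Inr i)) i) = c"
      unfolding system_colorings_def PiE_iff V by (auto simp: fun_eq_iff extensional_def)
    show "\<forall>d\<in>cycle_colorings n A (\<lambda>_ x. x).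
        (\<lambda>i\<in>{..<n}. (\<lambda>u\<in>cone_verts 0 n. case u of Inr i \<Rightarrow> d i) (Inr i)) = d"
      by (auto simp: V cycle_colorings_def PiE_iff fun_eq_iff extensional_def)
    show "(\<lambda>c. \<lambda>i\<in>{..<n}. c (Inr i)) ` ?S \<subseteq> cycle_colorings n A (\<lambda>_ x. x)"
    proof (rule image_subsetI)
      fix c assume c: "c \<in> ?S"
      show "(\<lambda>i\<in>{..<n}. c (Inr i)) \<in> cycle_colorings n A (\<lambda>_ x. x)"
      proof (rule cycle_coloringsI)
        show "(\<lambda>i\<in>{..<n}. c (Inr i)) \<in> {..<n} \<rightarrow>\<^sub>E A" using system_colorings_mem[OF c] by (auto simp: V)
        fix i assume i: "i < n"
        then show "(\<lambda>i\<in>{..<n}. c (Inr i)) (Suc i mod n) \<noteq> (\<lambda>i\<in>{..<n}. c (Inr i)) i"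
          using system_colorings_conflict_free[OF c, of "Inr i" "Inr (Suc i mod n)"] lt ne[OF i]
          by (auto simp: V equality_system_def cone_edge_iff)
      qed
    qed
    show "(\<lambda>d. \<lambda>u\<in>cone_verts 0 n. case u of Inr i \<Rightarrow> d i) ` cycle_colorings n A (\<lambda>_ x. x) \<subseteq> ?S"
    proof (rule image_subsetI)
      fix d assume d: "d \<in> cycle_colorings n A (\<lambda>_ x. x)"
      have st: "d (Suc i mod n) \<noteq> d i" if "i < n" for i using cycle_colorings_step[OF d that] .
      have "\<not> equality_system (cone_graph p' n) (Inr i) (Inr j) (d i) (d j)" if "i < n" "j < n" for i j
        using st[of i] st[of j] that by (auto simp: equality_system_def cone_edge_iff)
      then show "(\<lambda>u\<in>cone_verts 0 n. case u of Inr i \<Rightarrow> d i) \<in> ?S"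
        using cycle_colorings_mem[OF d] by (auto simp: system_colorings_def V)
    qed
  qed
  then have "card ?S = card (cycle_colorings n A (\<lambda>_ x. x))" by (rule bij_betw_same_card)
  moreover have "{x \<in> A. monodromy (\<lambda>_ x. x) n x = x} = A" by (auto simp: monodromy_fixed)
  ultimately show ?case
    using card_cycle_colorings[of A k n "\<lambda>_ x. x"] 0 n
    by (simp add: cone_poly_def bij_betw_def)
next
  case (Suc p)
  let ?E = "equality_system (cone_graph p' n)"
  have *: "system_colorings (cone_verts p n) (\<lambda>v. {y \<in> A. \<not> ?E (Inl p) v x y}) ?E
      = system_colorings (cone_verts p n) (\<lambda>_. A - {x}) ?E" for x
    using Suc.prems(1)
    by (intro system_colorings_cong) (auto simp: equality_system_def cone_verts_def cone_edge_iff)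
  have "card (system_colorings (insert (Inl p) (cone_verts p n)) (\<lambda>_. A) ?E)
      = (\<Sum>x\<in>A. card (system_colorings (cone_verts p n) (\<lambda>v. {y \<in> A. \<not> ?E (Inl p) v x y}) ?E))"
    using Suc.prems(2) finite_cone_verts Inl_notin_cone_verts
    by (intro card_system_colorings_insert) (auto simp: equality_system_def insert_commute)
  then have "int (card (system_colorings (cone_verts (Suc p) n) (\<lambda>_. A) ?E))
      = (\<Sum>x\<in>A. int (card (system_colorings (cone_verts p n) (\<lambda>_. A - {x}) ?E)))"
    by (simp add: cone_verts_Suc *)
  also have "\<dots> = (\<Sum>x\<in>A. cone_poly p n k)"
    using Suc.prems by (intro sum.cong Suc.IH) auto
  finally show ?case using Suc.prems by (simp add: cone_poly_Suc)
qed

lemma chromatic_poly_cone: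
  assumes "n \<ge> 3"
  shows "int (chromatic_poly (cone_graph p n) (p + k)) = cone_poly p n k"
  using card_cone_colorings[OF assms order.refl, of "{..<p + k}" p k]
  by (simp add: chromatic_poly_def proper_colorings_eq_system[OF simple_cone[OF assms]] uverts_cone)

text \<open>The upper bound comes from the canonical cover, whose colorings are the proper ones; the
  lower bound is applied to a cover that attains the minimum.\<close>

lemma dp_color_function_cone:
  assumes n: "n \<ge> 3" and p: "p \<ge> 1" and m: "m \<ge> p + 3"
  shows "dp_color_function (cone_graph p n) m = chromatic_poly (cone_graph p n) m"
proof (rule antisym)
  let ?G = "cone_graph p n"
  have G: "simple_graph ?G" using n by (rule simple_cone)
  have m1: "m \<ge> 1" using m by simp
  show "dp_color_function ?G m \<le> chromatic_poly ?G m"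
    using dp_color_function_le_system[OF G m1 matching_equality_system]
    by (simp add: chromatic_poly_def proper_colorings_eq_system[OF G])
  define k where "k = m - p"
  have k: "k \<ge> 3" "m = p + k" using m by (auto simp: k_def)
  obtain L :: "nat + nat \<Rightarrow> nat set" and H where cov: "fold_cover m ?G L H"
    and dp: "dp_color_function ?G m = card (cover_colorings ?G H)"
    using dp_color_function_attained[OF G m1] by blast
  have isc: "is_cover ?G L H" and cL: "\<And>u. u \<in> cone_verts p n \<Longrightarrow> card (L u) = p + k"
    using cov k by (auto simp: fold_cover_def uverts_cone)
  have "cone_poly p n k \<le> int (card (system_colorings (cone_verts p n) L (cover_conflict ?G L H)))"
    using cone_colorings_ge[OF matching_system_cover_conflict[OF isc] n k(1) p cL] .
  also have "card (system_colorings (cone_verts p n) L (cover_conflict ?G L H))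
      = dp_color_function ?G m"
    using card_cover_colorings[OF _ isc] finite_cone_verts by (simp add: uverts_cone dp)
  finally show "chromatic_poly ?G m \<le> dp_color_function ?G m"
    using chromatic_poly_cone[OF n, of p k] k by simp
qed

section \<open>Failure of equality with two colors beyond the apex\<close>

definition swap01 :: "nat \<Rightarrow> nat" where
  "swap01 x = (if x = 0 then 1 else if x = 1 then 0 else x)"

text \<open>Only the closing rim edge is twisted. \<open>swap01\<close> is an involution, so this
  edge reads the same in both directions and the relation stays symmetric.\<close>

definition twisted_system :: "nat \<Rightarrow> nat \<Rightarrow> nat + nat \<Rightarrow> nat + nat \<Rightarrow> nat \<Rightarrow> nat \<Rightarrow> bool" where
  "twisted_system p n u v x y \<longleftrightarrow> {u, v} \<in> uedges (cone_graph p n) \<and>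
     y = (if {u, v} = {Inr 0, Inr (n - 1)} then swap01 x else x)"

lemma matching_twisted_system: "matching_system (cone_graph p n) (twisted_system p n)"
  by (auto simp: matching_system_def twisted_system_def insert_commute swap01_def)

lemma dp_color_function_cone_less:
  assumes n: "n \<ge> 3" "even n"
  shows "dp_color_function (cone_graph p n) (p + 2) < chromatic_poly (cone_graph p n) (p + 2)"
proof -
  let ?G = "cone_graph p n" and ?V = "cone_verts p n"
  let ?T = "system_colorings ?V (\<lambda>_. {..<p + 2}) (twisted_system p n)"
  let ?S = "system_colorings ?V (\<lambda>_. {..<p + 2}) (equality_system ?G)"
  have n4: "n \<ge> 4" using n by (cases "n = 3") auto
  have "?T \<subseteq> ?S"
  proof
    fix c assume c: "c \<in> ?T"
    have apex: "c (Inl i) \<noteq> c (Inl j)" if "i < p" "j < p" "i \<noteq> j" for i j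
      using system_colorings_conflict_free[OF c, of "Inl i" "Inl j"] that
      by (auto simp: cone_verts_def twisted_system_def cone_edge_iff doubleton_eq_iff)
    have cone: "c (Inl i) \<noteq> c (Inr j)" if "i < p" "j < n" for i j
      using system_colorings_conflict_free[OF c, of "Inl i" "Inr j"] that
      by (auto simp: cone_verts_def twisted_system_def cone_edge_iff doubleton_eq_iff)
    have path: "c (Inr i) \<noteq> c (Inr (Suc i))" if "Suc i < n" for i
      using system_colorings_conflict_free[OF c, of "Inr i" "Inr (Suc i)"] that n4
      by (auto simp: cone_verts_def twisted_system_def cone_edge_iff doubleton_eq_iff split: if_splits)
    \<comment> \<open>The apex vertices use \<open>p\<close> distinct colors, so \<open>B\<close>
      holds the two colors left for the rim.\<close>
    define B where "B = {..<p + 2} - (\<lambda>i. c (Inl i)) ` {..<p}"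
    have "inj_on (\<lambda>i. c (Inl i)) {..<p}" using apex by (auto simp: inj_on_def)
    moreover have "(\<lambda>i. c (Inl i)) ` {..<p} \<subseteq> {..<p + 2}"
      using system_colorings_mem[OF c] by (auto simp: cone_verts_def)
    ultimately have B: "finite B" "card B = 2"
      by (auto simp: B_def card_Diff_subset card_image)
    have cB: "c (Inr i) \<in> B" if "i < n" for i
      using system_colorings_mem[OF c, of "Inr i"] cone[of _ i] that
      by (auto simp: B_def cone_verts_def) metis
    have c01: "c (Inr 0) \<noteq> c (Inr 1)" using path[of 0] n4 by simp
    have "{c (Inr 0), c (Inr 1)} = B"
      using B cB[of 0] cB[of 1] n4 c01 by (intro card_subset_eq) auto
    then have two: "c (Inr i) = c (Inr 0) \<or> c (Inr i) = c (Inr 1)" if "i < n" for i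
      using cB[OF that] by blast
    \<comment> \<open>With two colors the rim alternates along its untwisted path; as
      \<open>n\<close> is even, the ends \<open>0\<close> and \<open>n - 1\<close> differ, so the
      twisted edge is properly colored as well.\<close>
    have alt: "c (Inr i) = (if even i then c (Inr 0) else c (Inr 1))" if "i < n" for i
      using that
    proof (induction i)
      case (Suc i)
      then show ?case using two[of "Suc i"] path[of i] by (auto split: if_splits)
    qed simp
    have "c (Inr (n - 1)) = c (Inr 1)" using alt[of "n - 1"] n4 n(2) by simp
    then have last: "c (Inr 0) \<noteq> c (Inr (n - 1))" using c01 by simp
    have "\<not> equality_system ?G u v (c u) (c v)" if "u \<in> ?V" "v \<in> ?V" "u \<noteq> v" for u v
    proof (cases "{u, v} = {Inr 0, Inr (n - 1)}")
      case True
      then show ?thesis using last by (auto simp: equality_system_def doubleton_eq_iff)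
    next
      case False
      then show ?thesis using system_colorings_conflict_free[OF c that]
        by (auto simp: equality_system_def twisted_system_def)
    qed
    then show "c \<in> ?S" using c by (auto simp: system_colorings_def)
  qed
  moreover have "\<exists>c. c \<in> ?S \<and> c \<notin> ?T"
  proof -
    \<comment> \<open>The rim alternates between exactly the swapped colors 0 and 1, so its ends get
      0 and \<open>1 = swap01 0\<close>: a proper coloring that the twist forbids.\<close>
    define c where "c = (\<lambda>u\<in>?V. case u of Inl i \<Rightarrow> i + 2 | Inr i \<Rightarrow> i mod 2)"
    have cs: "i < p \<Longrightarrow> c (Inl i) = i + 2" "j < n \<Longrightarrow> c (Inr j) = j mod 2" for i j
      by (auto simp: c_def cone_verts_def)
    have par: "Suc i mod n mod 2 \<noteq> i mod 2" if "i < n" for i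
      using n that by (cases "Suc i = n") (auto simp: mod_Suc even_iff_mod_2_eq_zero split: if_splits)
    have "\<not> equality_system ?G u v (c u) (c v)" if "u \<in> ?V" "v \<in> ?V" "u \<noteq> v" for u v
      using that par par[THEN not_sym] by (auto simp: equality_system_def cone_verts_def cs cone_edge_iff)
    moreover have "c u \<in> {..<p + 2}" if "u \<in> ?V" for u
      using that by (auto simp: cone_verts_def cs)
    moreover have "c \<in> extensional ?V" by (simp add: c_def)
    ultimately have "c \<in> ?S" unfolding system_colorings_def PiE_iff by blast
    moreover have "twisted_system p n (Inr 0) (Inr (n - 1)) (c (Inr 0)) (c (Inr (n - 1)))"
    proof -
      have "odd (n - 1)" using n4 n(2) by simp
      then have "(n - 1) mod 2 = 1" by presburger
      then have "c (Inr (n - 1)) = 1" "c (Inr 0) = 0" using cs(2) n4 by auto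
      moreover have "{Inr 0, Inr (n - 1)} \<in> uedges ?G" using n4 by (simp add: cone_edge_iff)
      ultimately show ?thesis by (simp add: twisted_system_def swap01_def)
    qed
    then have "c \<notin> ?T"
      using system_colorings_conflict_free[of c ?V "\<lambda>_. {..<p + 2}" "twisted_system p n" "Inr 0" "Inr (n - 1)"] n4
      by (auto simp: cone_verts_def)
    ultimately show ?thesis by blast
  qed
  ultimately have "?T \<subset> ?S" by blast
  then have "card ?T < card ?S"
    by (intro psubset_card_mono finite_system_colorings finite_cone_verts) auto
  moreover have "dp_color_function ?G (p + 2) \<le> card ?T"
    using dp_color_function_le_system[OF simple_cone[OF n(1)] _ matching_twisted_system, of "p + 2" p]
    by (simp add: uverts_cone)
  ultimately show ?thesis
    by (simp add: chromatic_poly_def proper_colorings_eq_system[OF simple_cone[OF n(1)]] uverts_cone)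
qed

section \<open>The exact threshold\<close>

lemma proper_colorings_mono: "k \<le> m \<Longrightarrow> proper_colorings G k \<subseteq> proper_colorings G m"
  unfolding proper_colorings_def PiE_iff by fastforce

theorem theorem1p9:
  fixes p n :: nat
  assumes "p \<ge> 1" and "n \<ge> 3"
  shows "tau_DP (graph_join (complete_graph p) (cycle_graph n)) = enat (3 + p)"
proof -
  let ?G = "cone_graph p n"
  \<comment> \<open>At \<open>k = 3\<close> the cycle factor is
    \<open>2 ^ n + (- 1) ^ n * 2\<close>, positive for either parity, so the chromatic number is at
    most \<open>p + 3\<close>.\<close>
  have "(2 :: int) ^ 1 < 2 ^ n" using assms(2) by (intro power_strict_increasing) auto
  then have "0 < (2 :: int) ^ n + (- 1) ^ n * 2" by (cases "even n") auto
  then have "0 < cone_poly p n 3" by (simp add: cone_poly_def prod_pos)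
  then have "chromatic_poly ?G (p + 3) > 0" using chromatic_poly_cone[OF assms(2), of p 3] by linarith
  then have nonempty: "proper_colorings ?G (p + 3) \<noteq> {}" by (auto simp: chromatic_poly_def)
  have eq: "dp_color_function ?G m = chromatic_poly ?G m" if "m \<ge> p + 3" for m
    using dp_color_function_cone[OF assms(2,1) that] .
  then have "\<not> (\<exists>\<^sub>\<infinity>m. dp_color_function ?G m < chromatic_poly ?G m)"
    unfolding INFM_nat by (metis less_imp_le less_irrefl)
  moreover have "(LEAST N. chromatic_number ?G \<le> N \<and>
      (\<forall>m\<ge>N. dp_color_function ?G m = chromatic_poly ?G m)) = 3 + p"
  proof (rule Least_equality)
    have "chromatic_number ?G \<le> p + 3"
      unfolding chromatic_number_def using nonempty by (rule Least_le)
    then show "chromatic_number ?G \<le> 3 + p \<and>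
        (\<forall>m\<ge>3 + p. dp_color_function ?G m = chromatic_poly ?G m)"
      using eq by (simp add: add.commute)
  next
    fix N assume N: "chromatic_number ?G \<le> N \<and>
      (\<forall>m\<ge>N. dp_color_function ?G m = chromatic_poly ?G m)"
    show "3 + p \<le> N"
    proof (rule ccontr)
      assume "\<not> 3 + p \<le> N"
      then have le: "N \<le> p + 2" by simp
      show False
      proof (cases "even n")
        case True
        then show False using dp_color_function_cone_less[OF assms(2) True, of p] N le by simp
      next
        case False
        \<comment> \<open>At \<open>k = 2\<close> and odd \<open>n\<close> the cycle factor is
          \<open>1 - 1\<close>. Here \<open>N\<close> fails because it lies below the chromatic
          number, whereas for even \<open>n\<close> equality itself fails at
          \<open>p + 2\<close>.\<close>
        have "cone_poly p n 2 = 0" using False by (simp add: cone_poly_def)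
        then have "card (proper_colorings ?G (p + 2)) = 0"
          using chromatic_poly_cone[OF assms(2), of p 2] by (simp add: chromatic_poly_def)
        then have none: "proper_colorings ?G (p + 2) = {}"
          using finite_system_colorings[OF finite_cone_verts, of p n "\<lambda>_. {..<p + 2}"]
          by (simp add: proper_colorings_eq_system[OF simple_cone[OF assms(2)]] uverts_cone)
        have "proper_colorings ?G (chromatic_number ?G) \<noteq> {}"
          unfolding chromatic_number_def using nonempty by (rule LeastI)
        then show False using none proper_colorings_mono[of "chromatic_number ?G" "p + 2" ?G] N le by auto
      qed
    qed
  qed
  ultimately show ?thesis by (simp add: tau_DP_def)
qed

end
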